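(* Consider the plant model and the Joint Purchasing and Pricing Algorithm (JPP) described in the context. Suppose that for all $m\in\{1,\ldots,M\}$ $$\theta_m=\max_{\{k\in\{1,\ldots,K\}\,|\,\beta_{mk}>0\}}\left[\frac{V(P_{k,max}-\alpha_k)}{\beta_{mk}}+\sum_{i\in\{1,\ldots,M\},\,i\ne m}\frac{\beta_{ik}A_{i,max}}{\beta_{mk}}+2\mu_{m,max}\right],$$ and that $\mu_{m,max}\le Q_m(0)\le\theta_m+A_{m,max}$ for all $m\in\{1,\ldots,M\}$. Suppose $X(t)$ and $Y(t)$ are i.i.d. over slots. Then under the JPP algorithm implemented with any parameter $V>0$: (a) For all $m\in\{1,\ldots,M\}$ and all slots $t\ge0$, $$\mu_{m,max}\le Q_m(t)\le Q_{m,max}:=\theta_m+A_{m,max},$$ where $Q_{m,max}=O(V)$. (b) For all slots $t>0$, $$\frac1t\sum_{\tau=0}^{t-1}\mathbb{E}\{\phi_{actual}(\tau)\}\ge\phi^{opt}-\frac BV-\frac{\mathbb{E}\{L(\boldsymbol Q(0))\}}{Vt},$$ where $B=\frac12\sum_{m=1}^M\max[A_{m,max}^2,\mu_{m,max}^2]$ is independent of $V$, $L(\boldsymbol Q(t))=\frac12\sum_{m=1}^M(Q_m(t)-\theta_m)^2$, and $\phi^{opt}$ is the optimal time average profit defined in the context. (c) The time average profit converges with probability 1, and satisfies $$\lim_{t\rightarrow\infty}\frac1t\sum_{\tau=0}^{t-1}\phi_{actual}(\tau)\ge\phi^{opt}-\frac BV\quad\text{(with probability 1)}.$$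
   Context: **Plant model.** There are $M$ raw materials, $K$ products, and slots $t\in\{0,1,2,\ldots\}$. The nonnegative integer $\beta_{mk}$ is the number of units of material $m$ needed for one unit of product $k$ (each material is used by at least one product); $\alpha_k\ge0$ is the cost of assembling one unit of product $k$. *Supply and purchasing.* The supply state $X(t)=[(x_1(t),\ldots,x_M(t));(s_1(t),\ldots,s_M(t))]$ takes values in a finite or countably infinite set $\mathcal X$ with $\pi(x)=Pr[X(t)=x]$; $x_m(t)\ge0$ is the per-unit price of material $m$ and $s_m(t)\ge0$ the amount available. The purchase vector $\boldsymbol A(t)$ costs $c(\boldsymbol A(t),X(t))=\sum_{m=1}^Mx_m(t)A_m(t)$ and must lie in $\mathcal A(X(t))$, the set of integer vectors with $0\le A_m(t)\le\min[A_{m,max},s_m(t)]$ for all $m$ and $c(\boldsymbol A(t),X(t))\le c_{max}$ ($A_{m,max},c_{max}$ finite constants). *Demand and pricing.* The demand state $Y(t)$ takes values in a finite or countably infinite set $\mathcal Y$ with $\pi(y)=Pr[Y(t)=y]$. Each slot the plant observes $\boldsymbol Q(t),X(t),Y(t)$, then chooses $\boldsymbol A(t)$, $Z_k(t)\in\{0,1\}$ ($1$ means product $k$ is offered) and prices $P_k(t)\in\mathcal P_k$, a compact set of nonnegative prices with maximum $P_{k,max}$. Consumers then generate integer demands $0\le D_k(t)\le D_{k,max}$ (finite integers); $D_k(t)$ depends on $P_k(t),Y(t)$, is conditionally i.i.d. over all slots with the same $P_k(t),Y(t)$ values (its conditional law given the past, current states and decisions depends only on $P_k(t),Y(t)$),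 with mean $F_k(p,y)=\mathbb{E}\{D_k(t)\mid P_k(t)=p,Y(t)=y\}$ continuous in $p\in\mathcal P_k$ for each $y$. "$X(t)$ and $Y(t)$ i.i.d. over slots" means that the pairs $(X(t),Y(t))$, $t\ge0$, are i.i.d. with marginals $\pi(x),\pi(y)$, so $(X(t),Y(t))$ is independent of $\boldsymbol Q(t)$. *Queues and profit.* The integer inventories evolve as $Q_m(t+1)=\max[Q_m(t)-\sum_k\beta_{mk}\tilde D_k(t),0]+A_m(t)$, where $\tilde D_k(t)$ is the number of units of product $k$ actually sold. Define $\mu_{m,max}=\sum_{k=1}^K\beta_{mk}D_{k,max}$. The actual profit is $\phi_{actual}(t)=-c(\boldsymbol A(t),X(t))+\sum_{k=1}^KZ_k(t)\tilde D_k(t)(P_k(t)-\alpha_k)$. **JPP algorithm** (parameters $V>0$ and $\theta_m$). Let $1_k(t)=1$ if $Q_m(t)<\mu_{m,max}$ for some $m$ with $\beta_{mk}>0$, and $1_k(t)=0$ otherwise. Every slot $t$: (1) *Purchasing:* choose $\boldsymbol A(t)$ minimizing $Vc(\boldsymbol A(t),X(t))+\sum_{m=1}^MA_m(t)(Q_m(t)-\theta_m)$ subject to $\boldsymbol A(t)\in\mathcal A(X(t))$. (2) *Pricing:* for each $k$, if $1_k(t)=1$ set $Z_k(t)=0$. If $1_k(t)=0$, choose $P_k(t)\in\mathcal P_k$ maximizing $V(P_k(t)-\alpha_k)F_k(P_k(t),Y(t))+F_k(P_k(t),Y(t))\sum_{m=1}^M\beta_{mk}(Q_m(t)-\theta_m)$;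 if the maximum is positive set $Z_k(t)=1$, else set $Z_k(t)=0$. (3) *Queue update:* fulfil all demands for offered products, i.e. $Q_m(t+1)=Q_m(t)-\sum_{k=1}^K\beta_{mk}Z_k(t)D_k(t)+A_m(t)$ (there is always enough material, so $\tilde D_k(t)=Z_k(t)D_k(t)$). Minimizers and maximizers are selected by a fixed rule depending only on the current $\boldsymbol Q(t),X(t),Y(t)$. **Optimal profit.** $\phi^{opt}$ is the maximum of $-\hat c+\hat r$ over all choices of probability distributions $\theta(\cdot,x)$ on $\mathcal A(x)$ for each $x\in\mathcal X$, and of conditional distributions, given $Y(t)=y$, of random vectors $\boldsymbol Z(t)\in\{0,1\}^K$, $\boldsymbol P(t)\in\mathcal P_1\times\cdots\times\mathcal P_K$ for each $y\in\mathcal Y$, subject to $\hat a_m\ge\hat\mu_m$ for all $m$, where $\hat c=\sum_x\pi(x)\sum_{\boldsymbol a\in\mathcal A(x)}\theta(\boldsymbol a,x)c(\boldsymbol a,x)$, $\hat a_m=\sum_x\pi(x)\sum_{\boldsymbol a\in\mathcal A(x)}\theta(\boldsymbol a,x)a_m$, $\hat r=\sum_y\pi(y)\sum_k\mathbb{E}\{Z_k(t)(P_k(t)-\alpha_k)F_k(P_k(t),y)\mid Y(t)=y\}$, $\hat\mu_m=\sum_y\pi(y)\sum_k\beta_{mk}\mathbb{E}\{Z_k(t)F_k(P_k(t),y)\mid Y(t)=y\}$. In (a), $O(V)$ is with all parameters other than $V$ held fixed.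
   Formalization: The demand vector (D_1(t),...,D_K(t)), not just each D_k(t), is assumed to have a conditional law given the past, states and decisions depending only on P(t),Y(t), since otherwise (c) can fail; and (X(t),Y(t)) is assumed independent of the whole past, not only of Q(t). *)

theory Defs
  imports "HOL-Probability.Probability" "HOL-Library.Landau_Symbols"
begin

text \<open>Materials and products are the elements of the finite types \<open>'m\<close> and \<open>'k\<close>.
  A supply state is the pair of its price vector and its availability vector.\<close>

type_synonym 'm supply_state = "('m \<Rightarrow> real) \<times> ('m \<Rightarrow> real)"

record ('m, 'k, 'y) plant =
  beta :: "'m \<Rightarrow> 'k \<Rightarrow> nat"
  alpha :: "'k \<Rightarrow> real"
  supply_states :: "'m supply_state set"
  supply_pmf :: "'m supply_state pmf"
  buy_max :: "'m \<Rightarrow> real"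
  cost_max :: real
  demand_states :: "'y set"
  demand_state_pmf :: "'y pmf"
  price_set :: "'k \<Rightarrow> real set"
  demand_max :: "'k \<Rightarrow> nat"
  demand_law :: "'k \<Rightarrow> real \<Rightarrow> 'y \<Rightarrow> nat pmf"
  joint_demand_law :: "('k \<Rightarrow> real) \<Rightarrow> 'y \<Rightarrow> ('k \<Rightarrow> nat) pmf"

text \<open>\<open>demand_law pl k p y\<close> is the conditional law of the demand for product \<open>k\<close> when its
  price is \<open>p\<close> and the demand state is \<open>y\<close>.  \<open>joint_demand_law pl p y\<close> is the conditional law
  of the whole demand vector under the price vector \<open>p\<close>; only its one-dimensional marginals are
  prescribed, so demands for different products may be dependent within a slot.\<close>

text \<open>The price sets are compact and nonempty, so the supremum is the maximum.\<close>

definition price_max :: "('m, 'k, 'y) plant \<Rightarrow> 'k \<Rightarrow> real" where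
  "price_max pl k = Sup (price_set pl k)"

definition mean_demand :: "('m, 'k, 'y) plant \<Rightarrow> 'k \<Rightarrow> real \<Rightarrow> 'y \<Rightarrow> real" where
  "mean_demand pl k p y = measure_pmf.expectation (demand_law pl k p y) real"

definition mu_max :: "('m, 'k::finite, 'y) plant \<Rightarrow> 'm \<Rightarrow> nat" where
  "mu_max pl m = (\<Sum>k\<in>UNIV. beta pl m k * demand_max pl k)"

definition cost :: "('m::finite \<Rightarrow> int) \<Rightarrow> 'm supply_state \<Rightarrow> real" where
  "cost a x = (\<Sum>m\<in>UNIV. fst x m * of_int (a m))"

definition purchases ::
  "('m::finite, 'k, 'y) plant \<Rightarrow> 'm supply_state \<Rightarrow> ('m \<Rightarrow> int) set" where
  "purchases pl x =
     {a. (\<forall>m. 0 \<le> a m \<and> of_int (a m) \<le> min (buy_max pl m) (snd x m)) \<and> cost a x \<le> cost_max pl}"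

locale plant_model =
  fixes pl :: "('m::finite, 'k::finite, 'y) plant"
  assumes material_used: "\<exists>k. 0 < beta pl m k"
    and alpha_nonneg: "0 \<le> alpha pl k"
    and buy_max_nonneg: "0 \<le> buy_max pl m"
    and cost_max_nonneg: "0 \<le> cost_max pl"
    and countable_supply: "countable (supply_states pl)"
    and supply_pmf: "set_pmf (supply_pmf pl) \<subseteq> supply_states pl"
    and supply_nonneg: "x \<in> supply_states pl \<Longrightarrow> 0 \<le> fst x m \<and> 0 \<le> snd x m"
    and countable_demand: "countable (demand_states pl)"
    and demand_state_pmf: "set_pmf (demand_state_pmf pl) \<subseteq> demand_states pl"
    and price_compact: "compact (price_set pl k)"
    and price_nonempty: "price_set pl k \<noteq> {}"
    and price_nonneg: "p \<in> price_set pl k \<Longrightarrow> 0 \<le> p"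
    and demand_bounded: "\<lbrakk>p \<in> price_set pl k; y \<in> demand_states pl\<rbrakk> \<Longrightarrow>
          set_pmf (demand_law pl k p y) \<subseteq> {..demand_max pl k}"
    and mean_demand_continuous: "y \<in> demand_states pl \<Longrightarrow>
          continuous_on (price_set pl k) (\<lambda>p. mean_demand pl k p y)"
    and joint_demand_marginal: "\<lbrakk>\<And>j. ps j \<in> price_set pl j; y \<in> demand_states pl\<rbrakk> \<Longrightarrow>
          map_pmf (\<lambda>d. d k) (joint_demand_law pl ps y) = demand_law pl k (ps k) y"

record ('m, 'k) decision =
  buy :: "'m \<Rightarrow> int"
  offer :: "'k \<Rightarrow> bool"
  price :: "'k \<Rightarrow> real"

record ('w, 'm, 'k, 'y) trajectory =
  supplies :: "nat \<Rightarrow> 'w \<Rightarrow> 'm supply_state"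
  market :: "nat \<Rightarrow> 'w \<Rightarrow> 'y"
  decide :: "nat \<Rightarrow> 'w \<Rightarrow> ('m, 'k) decision"
  demand :: "nat \<Rightarrow> 'w \<Rightarrow> 'k \<Rightarrow> nat"
  sold :: "nat \<Rightarrow> 'w \<Rightarrow> 'k \<Rightarrow> nat"
  inventory :: "nat \<Rightarrow> 'w \<Rightarrow> 'm \<Rightarrow> int"

text \<open>Everything that has happened up to the beginning of slot \<open>t\<close>, including the inventories
  at that moment but not the states of slot \<open>t\<close>.\<close>

definition past where
  "past R t \<omega> =
     (map (\<lambda>\<tau>. inventory R \<tau> \<omega>) [0..<Suc t],
      map (\<lambda>\<tau>. (supplies R \<tau> \<omega>, market R \<tau> \<omega>, decide R \<tau> \<omega>, demand R \<tau> \<omega>)) [0..<t])"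

text \<open>Assumption \<open>demand_conditional\<close> says that, given the past and the current states and
  decisions, the demand vector is distributed according to \<open>joint_demand_law\<close>.  The elementary form,
  by atoms, suffices because the conditioning variables have countable range when, as below,
  decisions are a function of the current inventories and states.\<close>

locale plant_run = plant_model pl + prob_space M
  for pl :: "('m::finite, 'k::finite, 'y) plant" and M :: "'w measure" +
  fixes R :: "('w, 'm, 'k, 'y) trajectory"
  assumes supply_measurable: "supplies R t \<in> M \<rightarrow>\<^sub>M count_space UNIV"
    and market_measurable: "market R t \<in> M \<rightarrow>\<^sub>M count_space UNIV"
    and demand_measurable: "demand R t \<in> M \<rightarrow>\<^sub>M count_space UNIV"
    and inventory_measurable: "inventory R 0 \<in> M \<rightarrow>\<^sub>M count_space UNIV"
    and supply_in: "\<omega> \<in> space M \<Longrightarrow> supplies R t \<omega> \<in> supply_states pl"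
    and market_in: "\<omega> \<in> space M \<Longrightarrow> market R t \<omega> \<in> demand_states pl"
    and supply_law: "prob {\<omega>\<in>space M. supplies R t \<omega> = x} = pmf (supply_pmf pl) x"
    and market_law: "prob {\<omega>\<in>space M. market R t \<omega> = y} = pmf (demand_state_pmf pl) y"
    and buy_feasible: "\<omega> \<in> space M \<Longrightarrow> buy (decide R t \<omega>) \<in> purchases pl (supplies R t \<omega>)"
    and price_feasible: "\<omega> \<in> space M \<Longrightarrow> price (decide R t \<omega>) k \<in> price_set pl k"
    and demand_le: "\<omega> \<in> space M \<Longrightarrow> demand R t \<omega> k \<le> demand_max pl k"
    and demand_conditional:
      "prob {\<omega>\<in>space M. past R t \<omega> = h \<and> supplies R t \<omega> = x \<and> market R t \<omega> = y \<and>
                        decide R t \<omega> = c \<and> demand R t \<omega> = d}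
       = prob {\<omega>\<in>space M. past R t \<omega> = h \<and> supplies R t \<omega> = x \<and> market R t \<omega> = y \<and>
                          decide R t \<omega> = c}
         * pmf (joint_demand_law pl (price c) y) d"
    and inventory_step: "\<omega> \<in> space M \<Longrightarrow>
          inventory R (Suc t) \<omega> m =
            max (inventory R t \<omega> m - (\<Sum>k\<in>UNIV. int (beta pl m k * sold R t \<omega> k))) 0
            + buy (decide R t \<omega>) m"

definition phi_actual ::
  "('m::finite, 'k::finite, 'y) plant \<Rightarrow> ('w, 'm, 'k, 'y) trajectory \<Rightarrow> nat \<Rightarrow> 'w \<Rightarrow> real" where
  "phi_actual pl R t \<omega> =
     - cost (buy (decide R t \<omega>)) (supplies R t \<omega>)
     + (\<Sum>k\<in>UNIV. of_bool (offer (decide R t \<omega>) k) * real (sold R t \<omega> k)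
                   * (price (decide R t \<omega>) k - alpha pl k))"

text \<open>The pairs of states are i.i.d. over slots, possibly dependent within a slot.  The last conjunct
  makes the states of a slot independent of the whole past, in particular of the current inventories,
  which mutual independence of the pairs alone does not give.\<close>

definition iid_states :: "'w measure \<Rightarrow> ('w, 'm, 'k, 'y) trajectory \<Rightarrow> bool" where
  "iid_states M R \<longleftrightarrow>
     prob_space.indep_vars M (\<lambda>_. count_space UNIV) (\<lambda>t \<omega>. (supplies R t \<omega>, market R t \<omega>)) UNIV \<and>
     (\<forall>t. distr M (count_space UNIV) (\<lambda>\<omega>. (supplies R t \<omega>, market R t \<omega>)) =
          distr M (count_space UNIV) (\<lambda>\<omega>. (supplies R 0 \<omega>, market R 0 \<omega>))) \<and>
     (\<forall>t. prob_space.indep_set M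
            (sets (vimage_algebra (space M) (past R t) (count_space UNIV)))
            (sets (vimage_algebra (space M) (\<lambda>\<omega>. (supplies R t \<omega>, market R t \<omega>)) (count_space UNIV))))"

definition short :: "('m, 'k::finite, 'y) plant \<Rightarrow> ('m \<Rightarrow> int) \<Rightarrow> 'k \<Rightarrow> bool" where
  "short pl q k \<longleftrightarrow> (\<exists>m. 0 < beta pl m k \<and> q m < int (mu_max pl m))"

definition purchase_metric ::
  "real \<Rightarrow> ('m::finite \<Rightarrow> real) \<Rightarrow> ('m \<Rightarrow> int) \<Rightarrow> 'm supply_state \<Rightarrow> ('m \<Rightarrow> int) \<Rightarrow> real" where
  "purchase_metric V \<theta> q x a =
     V * cost a x + (\<Sum>m\<in>UNIV. of_int (a m) * (of_int (q m) - \<theta> m))"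

definition pricing_metric ::
  "('m::finite, 'k, 'y) plant \<Rightarrow> real \<Rightarrow> ('m \<Rightarrow> real) \<Rightarrow> ('m \<Rightarrow> int) \<Rightarrow> 'y \<Rightarrow> 'k \<Rightarrow> real \<Rightarrow> real" where
  "pricing_metric pl V \<theta> q y k p =
     V * (p - alpha pl k) * mean_demand pl k p y
     + mean_demand pl k p y * (\<Sum>m\<in>UNIV. real (beta pl m k) * (of_int (q m) - \<theta> m))"

definition jpp_decision ::
  "('m::finite, 'k::finite, 'y) plant \<Rightarrow> real \<Rightarrow> ('m \<Rightarrow> real) \<Rightarrow>
   ('m \<Rightarrow> int) \<Rightarrow> 'm supply_state \<Rightarrow> 'y \<Rightarrow> ('m, 'k) decision \<Rightarrow> bool" where
  "jpp_decision pl V \<theta> q x y c \<longleftrightarrow>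
     is_arg_min (purchase_metric V \<theta> q x) (\<lambda>a. a \<in> purchases pl x) (buy c) \<and>
     (\<forall>k. if short pl q k then \<not> offer c k
          else is_arg_max (pricing_metric pl V \<theta> q y k) (\<lambda>p. p \<in> price_set pl k) (price c k) \<and>
               (offer c k \<longleftrightarrow> 0 < pricing_metric pl V \<theta> q y k (price c k)))"

locale jpp_run = plant_run pl M R
  for pl :: "('m::finite, 'k::finite, 'y) plant" and M :: "'w measure"
    and R :: "('w, 'm, 'k, 'y) trajectory" +
  fixes V :: real and \<theta> :: "'m \<Rightarrow> real"
  assumes jpp: "\<omega> \<in> space M \<Longrightarrow>
        jpp_decision pl V \<theta> (inventory R t \<omega>) (supplies R t \<omega>) (market R t \<omega>) (decide R t \<omega>)"
    and fixed_rule: "\<exists>rule. \<forall>t. \<forall>\<omega>\<in>space M.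
        decide R t \<omega> = rule (inventory R t \<omega>) (supplies R t \<omega>) (market R t \<omega>)"
    and fulfil_all: "\<omega> \<in> space M \<Longrightarrow>
        sold R t \<omega> k = of_bool (offer (decide R t \<omega>) k) * demand R t \<omega> k"

text \<open>There is always enough material to fulfil all demands for offered products, so the cut-off at
  zero in the inventory dynamics is never active.\<close>

lemma (in jpp_run) enough_material:
  assumes \<omega>: "\<omega> \<in> space M" and q: "0 \<le> inventory R t \<omega> m"
  shows "(\<Sum>k\<in>UNIV. int (beta pl m k * sold R t \<omega> k)) \<le> inventory R t \<omega> m"
proof (cases "\<exists>k. 0 < beta pl m k \<and> offer (decide R t \<omega>) k")
  case True
  then obtain k where k: "0 < beta pl m k" "offer (decide R t \<omega>) k" by blast
  from jpp[OF \<omega>, of t] k(2) have "\<not> short pl (inventory R t \<omega>) k"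
    unfolding jpp_decision_def by metis
  with k(1) have "int (mu_max pl m) \<le> inventory R t \<omega> m"
    by (force simp: short_def not_less)
  moreover have "(\<Sum>k\<in>UNIV. int (beta pl m k * sold R t \<omega> k)) \<le> int (mu_max pl m)"
    unfolding mu_max_def of_nat_sum using demand_le[OF \<omega>, of t] 
    by (intro sum_mono) (auto simp: fulfil_all[OF \<omega>] simp del: of_nat_mult)
  ultimately show ?thesis by linarith
next
  case False
  then have "(\<Sum>k\<in>UNIV. int (beta pl m k * sold R t \<omega> k)) = 0"
    by (intro sum.neutral) (auto simp: fulfil_all[OF \<omega>])
  with q show ?thesis by simp
qed

lemma (in jpp_run) inventory_update:
  assumes \<omega>: "\<omega> \<in> space M" and q0: "\<And>m. 0 \<le> inventory R 0 \<omega> m"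
  shows "inventory R (Suc t) \<omega> m =
    inventory R t \<omega> m
    - (\<Sum>k\<in>UNIV. int (beta pl m k) * of_bool (offer (decide R t \<omega>) k) * int (demand R t \<omega> k))
    + buy (decide R t \<omega>) m"
proof -
  have "0 \<le> inventory R t \<omega> m"
  proof (cases t)
    case (Suc s)
    have "0 \<le> buy (decide R s \<omega>) m"
      using buy_feasible[OF \<omega>, of s] by (simp add: purchases_def)
    then show ?thesis by (simp add: Suc inventory_step[OF \<omega>])
  qed (simp add: q0)
  from enough_material[OF \<omega> this] show ?thesis
    by (simp add: inventory_step[OF \<omega>] fulfil_all[OF \<omega>] mult.assoc)
qed

definition theta :: "('m::finite, 'k::finite, 'y) plant \<Rightarrow> real \<Rightarrow> 'm \<Rightarrow> real" where
  "theta pl V m =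
     Max ((\<lambda>k. V * (price_max pl k - alpha pl k) / real (beta pl m k)
               + (\<Sum>i\<in>UNIV - {m}. real (beta pl i k) * buy_max pl i / real (beta pl m k))
               + 2 * real (mu_max pl m)) ` {k. 0 < beta pl m k})"

definition Q_max :: "('m::finite, 'k::finite, 'y) plant \<Rightarrow> real \<Rightarrow> 'm \<Rightarrow> real" where
  "Q_max pl V m = theta pl V m + buy_max pl m"

definition B_const :: "('m::finite, 'k::finite, 'y) plant \<Rightarrow> real" where
  "B_const pl = (1/2) * (\<Sum>m\<in>UNIV. max ((buy_max pl m)\<^sup>2) ((real (mu_max pl m))\<^sup>2))"

definition lyapunov :: "('m::finite \<Rightarrow> real) \<Rightarrow> ('m \<Rightarrow> int) \<Rightarrow> real" where
  "lyapunov \<theta> q = (1/2) * (\<Sum>m\<in>UNIV. (of_int (q m) - \<theta> m)\<^sup>2)"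

text \<open>The measurable space in which the random vectors of offers and prices take values.  Prices
  are restricted to the price sets, since the mean demand is measurable only there.\<close>

definition offer_space ::
  "('m, 'k::finite, 'y) plant \<Rightarrow> (('k \<Rightarrow> bool) \<times> ('k \<Rightarrow> real)) measure" where
  "offer_space pl =
     Pi\<^sub>M UNIV (\<lambda>_. count_space UNIV) \<Otimes>\<^sub>M Pi\<^sub>M UNIV (\<lambda>k. restrict_space borel (price_set pl k))"

definition purchase_policy ::
  "('m::finite, 'k, 'y) plant \<Rightarrow> ('m supply_state \<Rightarrow> ('m \<Rightarrow> int) pmf) \<Rightarrow> bool" where
  "purchase_policy pl \<theta> \<longleftrightarrow> (\<forall>x\<in>supply_states pl. set_pmf (\<theta> x) \<subseteq> purchases pl x)"

definition pricing_policy ::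
  "('m, 'k::finite, 'y) plant \<Rightarrow> ('y \<Rightarrow> (('k \<Rightarrow> bool) \<times> ('k \<Rightarrow> real)) measure) \<Rightarrow> bool" where
  "pricing_policy pl \<nu> \<longleftrightarrow>
     (\<forall>y\<in>demand_states pl. prob_space (\<nu> y) \<and> sets (\<nu> y) = sets (offer_space pl))"

definition c_hat ::
  "('m::finite, 'k, 'y) plant \<Rightarrow> ('m supply_state \<Rightarrow> ('m \<Rightarrow> int) pmf) \<Rightarrow> real" where
  "c_hat pl \<theta> = (\<Sum>\<^sub>\<infinity>x\<in>supply_states pl. pmf (supply_pmf pl) x *
     (\<Sum>a\<in>purchases pl x. pmf (\<theta> x) a * cost a x))"

definition a_hat ::
  "('m::finite, 'k, 'y) plant \<Rightarrow> ('m supply_state \<Rightarrow> ('m \<Rightarrow> int) pmf) \<Rightarrow> 'm \<Rightarrow> real" where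
  "a_hat pl \<theta> m = (\<Sum>\<^sub>\<infinity>x\<in>supply_states pl. pmf (supply_pmf pl) x *
     (\<Sum>a\<in>purchases pl x. pmf (\<theta> x) a * of_int (a m)))"

definition r_hat ::
  "('m, 'k::finite, 'y) plant \<Rightarrow> ('y \<Rightarrow> (('k \<Rightarrow> bool) \<times> ('k \<Rightarrow> real)) measure) \<Rightarrow> real" where
  "r_hat pl \<nu> = (\<Sum>\<^sub>\<infinity>y\<in>demand_states pl. pmf (demand_state_pmf pl) y *
     (\<Sum>k\<in>UNIV. \<integral>(z, p). of_bool (z k) * (p k - alpha pl k) * mean_demand pl k (p k) y \<partial>\<nu> y))"

definition mu_hat ::
  "('m, 'k::finite, 'y) plant \<Rightarrow> ('y \<Rightarrow> (('k \<Rightarrow> bool) \<times> ('k \<Rightarrow> real)) measure) \<Rightarrow> 'm \<Rightarrow> real" where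
  "mu_hat pl \<nu> m = (\<Sum>\<^sub>\<infinity>y\<in>demand_states pl. pmf (demand_state_pmf pl) y *
     (\<Sum>k\<in>UNIV. real (beta pl m k) * (\<integral>(z, p). of_bool (z k) * mean_demand pl k (p k) y \<partial>\<nu> y)))"

definition achievable_profits :: "('m::finite, 'k::finite, 'y) plant \<Rightarrow> real set" where
  "achievable_profits pl =
     {- c_hat pl \<theta> + r_hat pl \<nu> | \<theta> \<nu>. purchase_policy pl \<theta> \<and> pricing_policy pl \<nu> \<and>
        (\<forall>m. a_hat pl \<theta> m \<ge> mu_hat pl \<nu> m)}"

definition phi_opt :: "('m::finite, 'k::finite, 'y) plant \<Rightarrow> real" where
  "phi_opt pl = Sup (achievable_profits pl)"

text \<open>The supremum in \<open>phi_opt\<close> is a genuine least upper bound, and so the maximum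
  whenever that is attained.\<close>

context plant_model
begin

lemma achievable_profits_nonempty: "achievable_profits pl \<noteq> {}"
proof -
  define a0 :: "'m \<Rightarrow> int" where "a0 = (\<lambda>_. 0)"
  define \<theta> where "\<theta> = (\<lambda>x::'m supply_state. return_pmf a0)"
  define p where "p = (\<lambda>k. SOME p. p \<in> price_set pl k)"
  define z where "z = (\<lambda>k::'k. False)"
  define \<nu> where "\<nu> = (\<lambda>y::'y. return (offer_space pl) (z, p))"
  have p: "p k \<in> price_set pl k" for k
    unfolding p_def using price_nonempty by (simp add: some_in_eq)
  have zp: "(z, p) \<in> space (offer_space pl)"
    using p by (auto simp: offer_space_def space_pair_measure space_PiM space_restrict_space)
  have a0: "a0 \<in> purchases pl x" if "x \<in> supply_states pl" for x
    using supply_nonneg[OF that] buy_max_nonneg cost_max_nonneg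
    by (auto simp: purchases_def a0_def cost_def)
  have 1: "purchase_policy pl \<theta>"
    using a0 by (auto simp: purchase_policy_def \<theta>_def)
  have 2: "pricing_policy pl \<nu>"
    using zp by (auto simp: pricing_policy_def \<nu>_def intro: prob_space_return)
  have 3: "a_hat pl \<theta> m = 0" for m
    unfolding a_hat_def
    by (intro infsum_0) (auto simp: \<theta>_def a0_def pmf_return split: split_indicator intro!: sum.neutral)
  have 4: "mu_hat pl \<nu> m = 0" for m
  proof -
    have "(\<integral>(z, p). of_bool (z k) * mean_demand pl k (p k) y \<partial>\<nu> y) = 0" for k y
    proof (rule integral_eq_zero_AE)
      show "AE x in \<nu> y. (case x of (z, p) \<Rightarrow> of_bool (z k) * mean_demand pl k (p k) y) = 0"
      proof -
        have "{x\<in>space (offer_space pl). \<not> fst x k} \<in> sets (offer_space pl)"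
          unfolding offer_space_def by measurable
        then have "AE x in \<nu> y. \<not> fst x k"
          unfolding \<nu>_def using zp by (subst AE_return) (auto simp: z_def pred_def)
        then show ?thesis by (rule AE_mp) (auto intro!: AE_I2)
      qed
    qed
    then show ?thesis by (simp add: mu_hat_def)
  qed
  have "- c_hat pl \<theta> + r_hat pl \<nu> \<in> achievable_profits pl"
    unfolding achievable_profits_def using 1 2 3 4 by force
  then show ?thesis by blast
qed

lemma achievable_profits_bdd_above: "bdd_above (achievable_profits pl)"
proof -
  define C where "C = (\<Sum>k\<in>UNIV. (price_max pl k + alpha pl k) * real (demand_max pl k))"
  have md: "0 \<le> mean_demand pl k p y \<and> mean_demand pl k p y \<le> real (demand_max pl k)"
    if "p \<in> price_set pl k" "y \<in> demand_states pl" for k p y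
  proof -
    have fin: "finite (set_pmf (demand_law pl k p y))"
      using demand_bounded[OF that] finite_subset by blast
    have "mean_demand pl k p y \<le> measure_pmf.expectation (demand_law pl k p y) (\<lambda>_. real (demand_max pl k))"
      unfolding mean_demand_def using demand_bounded[OF that] fin
      by (intro integral_mono_AE integrable_measure_pmf_finite) (auto simp: AE_measure_pmf_iff)
    then show ?thesis by (simp add: mean_demand_def)
  qed
  have pm: "p \<le> price_max pl k" if "p \<in> price_set pl k" for p k
    unfolding price_max_def
    by (intro cSup_upper that bounded_imp_bdd_above compact_imp_bounded price_compact)
  have pm0: "0 \<le> price_max pl k" for k
    using price_nonempty[of k] pm price_nonneg by (metis all_not_in_conv order_trans)
  have C0: "0 \<le> C"
    unfolding C_def by (intro sum_nonneg mult_nonneg_nonneg add_nonneg_nonneg pm0 alpha_nonneg) auto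
  have bound: "\<bar>\<Sum>k\<in>UNIV. \<integral>(z, p). of_bool (z k) * (p k - alpha pl k) * mean_demand pl k (p k) y \<partial>\<nu> y\<bar> \<le> C"
    if \<nu>: "pricing_policy pl \<nu>" and y: "y \<in> demand_states pl" for \<nu> y
  proof -
    interpret N: prob_space "\<nu> y"
      using \<nu> y by (simp add: pricing_policy_def)
    have sp: "space (\<nu> y) = space (offer_space pl)"
      using \<nu> y by (intro sets_eq_imp_space_eq) (simp add: pricing_policy_def)
    have "\<bar>\<integral>(z, p). of_bool (z k) * (p k - alpha pl k) * mean_demand pl k (p k) y \<partial>\<nu> y\<bar>
          \<le> (price_max pl k + alpha pl k) * real (demand_max pl k)" for k
    proof -
      let ?f = "\<lambda>(z, p). of_bool (z k) * (p k - alpha pl k) * mean_demand pl k (p k) y"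
      let ?c = "(price_max pl k + alpha pl k) * real (demand_max pl k)"
      have c0: "0 \<le> ?c" by (intro mult_nonneg_nonneg add_nonneg_nonneg pm0 alpha_nonneg) auto
      have f: "\<bar>?f x\<bar> \<le> ?c" if "x \<in> space (\<nu> y)" for x
      proof -
        obtain z p where x: "x = (z, p)" by fastforce
        have p: "p k \<in> price_set pl k"
          using that unfolding sp x
          by (auto simp: offer_space_def space_pair_measure space_PiM space_restrict_space)
        have "\<bar>p k - alpha pl k\<bar> \<le> price_max pl k + alpha pl k"
          using pm[OF p] price_nonneg[OF p] alpha_nonneg[of k] pm0[of k] by linarith
        then have "\<bar>p k - alpha pl k\<bar> * \<bar>mean_demand pl k (p k) y\<bar> \<le> ?c"
          using md[OF p y] by (intro mult_mono) auto
        then show ?thesis using c0 by (simp add: x abs_mult)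
      qed
      show ?thesis
      proof (cases "integrable (\<nu> y) ?f")
        case True
        have "\<bar>\<integral>x. ?f x \<partial>\<nu> y\<bar> \<le> (\<integral>x. \<bar>?f x\<bar> \<partial>\<nu> y)" by (rule integral_abs_bound)
        also have "\<dots> \<le> (\<integral>x. ?c \<partial>\<nu> y)"
          using True f by (intro integral_mono integrable_abs) auto
        finally show ?thesis by (simp add: N.prob_space)
      qed (use c0 in \<open>simp add: not_integrable_integral_eq\<close>)
    qed
    then show ?thesis unfolding C_def by (intro sum_abs[THEN order_trans] sum_mono)
  qed
  have pmf_sum: "pmf q summable_on A" "infsum (pmf q) A \<le> 1" for q :: "'y pmf" and A
  proof -
    show s: "pmf q summable_on A" for A
      using abs_summable_equivalent pmf_abs_summable by (metis abs_summable_summable)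
    show "infsum (pmf q) A \<le> 1"
      using measure_pmf_conv_infsetsum[of q A] infsetsum_infsum[OF pmf_abs_summable[of q A]]
      by (metis measure_pmf.prob_le_1)
  qed
  have r: "r_hat pl \<nu> \<le> C" if \<nu>: "pricing_policy pl \<nu>" for \<nu>
  proof -
    let ?g = "\<lambda>y. \<Sum>k\<in>UNIV. \<integral>(z, p). of_bool (z k) * (p k - alpha pl k) * mean_demand pl k (p k) y \<partial>\<nu> y"
    let ?q = "pmf (demand_state_pmf pl)"
    have sC: "(\<lambda>y. ?q y * C) summable_on demand_states pl"
      by (intro summable_on_cmult_left pmf_sum)
    have le: "\<bar>?q y * ?g y\<bar> \<le> ?q y * C" if "y \<in> demand_states pl" for y
      unfolding abs_mult using bound[OF \<nu> that] by (simp add: mult_left_mono)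
    have s: "(\<lambda>y. ?q y * ?g y) summable_on demand_states pl"
      by (rule abs_summable_summable, rule summable_on_comparison_test[OF sC]) (use le in auto)
    have "r_hat pl \<nu> \<le> (\<Sum>\<^sub>\<infinity>y\<in>demand_states pl. ?q y * C)"
      unfolding r_hat_def using le by (intro infsum_mono s sC) (meson abs_le_D1)
    also have "\<dots> = infsum ?q (demand_states pl) * C"
      by (rule infsum_cmult_left) (use pmf_sum in auto)
    also have "\<dots> \<le> 1 * C" by (intro mult_right_mono pmf_sum C0)
    finally show ?thesis by simp
  qed
  have c: "0 \<le> c_hat pl \<theta>" for \<theta>
    unfolding c_hat_def
    by (intro infsum_nonneg mult_nonneg_nonneg sum_nonneg)
      (auto simp: cost_def purchases_def intro!: sum_nonneg mult_nonneg_nonneg dest: supply_nonneg)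
  show ?thesis
  proof (rule bdd_aboveI[where M = C])
    fix v assume "v \<in> achievable_profits pl"
    then obtain \<theta> \<nu> where "v = - c_hat pl \<theta> + r_hat pl \<nu>" "pricing_policy pl \<nu>"
      unfolding achievable_profits_def by blast
    with r[of \<nu>] c[of \<theta>] show "v \<le> C" by simp
  qed
qed

end

end

theory Submission
  imports Defs "HOL-Library.Discrete_Functions"
begin

text \<open>The inventory bounds come from the two thresholds built into the decision rule.  Above \<open>theta pl V m\<close>
every unit of material \<open>m\<close> has a strictly positive weight in the purchasing problem, so none is bought
(\<open>min_purchase_zero_above_threshold\<close>); below twice \<open>mu_max pl m\<close> the choice of \<open>theta\<close> makes the
pricing metric of every product that contains \<open>m\<close> nonpositive, so nothing containing \<open>m\<close> is sold
(\<open>pricing_metric_nonpos_when_low\<close>).  Both bounds are therefore invariant, no product is ever short,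
and the inventory vector lives in a finite box.

For the profit, let \<open>L\<close> be the Lyapunov function.  Expanding the square shows that \<open>V\<close> times the profit
of a slot minus the increment of \<open>L\<close> is at least \<open>- B\<close> minus the purchasing metric plus the collected
pricing metrics, taken with the realised demands (\<open>drift_bound\<close>).  Given the inventories, the algorithm optimises exactly these two
metrics, hence does at least as well as any randomised policy that ignores the inventories
(\<open>conditional_drift_ge_policy\<close>).  Averaging over the states, which are independent of the inventories,
turns the metrics of the policy into \<open>c_hat\<close>, \<open>a_hat\<close>, \<open>r_hat\<close> and \<open>mu_hat\<close>.  A policy may buy more than
it consumes, which is harmful when the inventory exceeds its threshold; the algorithm is therefore
compared with the policy that drops its purchases of exactly those materials, so that the constraint
\<open>mu_hat \<le> a_hat\<close> enters where the inventory is below the threshold and helps there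
(\<open>mean_drift_ge_policy\<close>).  The result is that, from every inventory vector that the run reaches, the
expected drift-corrected profit (profit minus increment of \<open>L / V\<close>) is at least
\<open>phi_opt - B / V\<close>.  Taking expectations and telescoping \<open>L\<close> gives the bound on the expected averages.

For almost sure convergence, the inventories form a Markov chain on a finite set, and the
drift-corrected profit of a slot is a function of the current inventories and the randomness of
that slot.  Its differences from the conditional means are bounded and orthogonal, so their averages
tend to zero.  It remains to see that time averages of a function \<open>f\<close> of the chain converge.  They do
not change in the limit when \<open>f\<close> is replaced by its image under the transition operator, hence by
any Cesaro mean of its images.  A limit point \<open>h\<close> of these means is harmonic, so \<open>h\<close> along the chain
is a bounded martingale; since it takes finitely many values and its increments are square summable,
it is eventually constant, and this constant is the limit.  The limit may depend
on the path, as the chain may have several recurrent classes, but it is a limit of averages of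
conditional means that are all at least \<open>phi_opt - B / V\<close>.\<close>

section \<open>Random variables with countable range\<close>

text \<open>Measurability with respect to the full power set is only well behaved under pairing when the range
is countable, so the two properties are carried together.\<close>

definition discrete_rv :: "'w measure \<Rightarrow> ('w \<Rightarrow> 'a) \<Rightarrow> bool" where
  "discrete_rv M X \<longleftrightarrow> X \<in> M \<rightarrow>\<^sub>M count_space UNIV \<and> countable (X ` space M)"

lemma discrete_rvI:
  assumes "countable (X ` space M)" "\<And>a. {\<omega> \<in> space M. X \<omega> = a} \<in> sets M"
  shows "discrete_rv M X"
proof -
  have "X \<in> M \<rightarrow>\<^sub>M count_space (X ` space M)"
    using assms(2) by (subst measurable_count_space_eq_countable[OF assms(1)])
      (auto simp: vimage_def Int_def conj_commute)
  then have "X \<in> M \<rightarrow>\<^sub>M count_space UNIV"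
    by (rule measurable_compose[where f=X and g="\<lambda>x. x"]) simp
  with assms(1) show ?thesis by (simp add: discrete_rv_def)
qed

lemma discrete_rv_measurable: "discrete_rv M X \<Longrightarrow> X \<in> M \<rightarrow>\<^sub>M count_space UNIV"
  by (simp add: discrete_rv_def)

lemma discrete_rv_sets [intro]: "discrete_rv M X \<Longrightarrow> {\<omega> \<in> space M. P (X \<omega>)} \<in> sets M"
  by (drule discrete_rv_measurable, drule measurable_sets[of _ _ _ "{a. P a}"])
    (auto simp: vimage_def Int_def conj_commute)

lemma discrete_rv_borel: "discrete_rv M X \<Longrightarrow> (\<lambda>\<omega>. f (X \<omega>)) \<in> borel_measurable M"
  by (drule discrete_rv_measurable) (erule measurable_compose, simp)

lemma discrete_rv_compose: "discrete_rv M X \<Longrightarrow> discrete_rv M (\<lambda>\<omega>. f (X \<omega>))"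
  unfolding discrete_rv_def image_image[symmetric, of f X]
  by (auto elim: measurable_compose)

lemma discrete_rv_cong: "(\<And>\<omega>. \<omega> \<in> space M \<Longrightarrow> X \<omega> = Y \<omega>) \<Longrightarrow> discrete_rv M X \<longleftrightarrow> discrete_rv M Y"
  unfolding discrete_rv_def by (intro conj_cong measurable_cong arg_cong[where f=countable] image_cong) auto

lemma discrete_rv_Pair:
  assumes X: "discrete_rv M X" and Y: "discrete_rv M Y"
  shows "discrete_rv M (\<lambda>\<omega>. (X \<omega>, Y \<omega>))"
proof (rule discrete_rvI)
  have "countable (X ` space M \<times> Y ` space M)"
    using X Y by (auto simp: discrete_rv_def)
  then show "countable ((\<lambda>\<omega>. (X \<omega>, Y \<omega>)) ` space M)"
    by (rule countable_subset[rotated]) auto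
  fix a :: "'b \<times> 'c"
  have "{\<omega> \<in> space M. (X \<omega>, Y \<omega>) = a} =
      {\<omega> \<in> space M. X \<omega> = fst a} \<inter> {\<omega> \<in> space M. Y \<omega> = snd a}" by auto
  then show "{\<omega> \<in> space M. (X \<omega>, Y \<omega>) = a} \<in> sets M"
    using discrete_rv_sets[OF X] discrete_rv_sets[OF Y] by auto
qed

lemma discrete_rv_map:
  "(\<And>i. i \<in> set is \<Longrightarrow> discrete_rv M (X i)) \<Longrightarrow> discrete_rv M (\<lambda>\<omega>. map (\<lambda>i. X i \<omega>) is)"
proof (induction "is")
  case Nil
  show ?case by (intro discrete_rvI) (auto simp: image_constant_conv)
next
  case (Cons i js)
  then have "discrete_rv M (\<lambda>\<omega>. (X i \<omega>, map (\<lambda>i. X i \<omega>) js))"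
    by (intro discrete_rv_Pair) auto
  from discrete_rv_compose[OF this, of "\<lambda>(a, as). a # as"] show ?case by simp
qed

lemma (in prob_space) discrete_rv_integrable:
  fixes f :: "'b \<Rightarrow> real"
  assumes X: "discrete_rv M X" and "AE \<omega> in M. \<bar>f (X \<omega>)\<bar> \<le> C"
  shows "integrable M (\<lambda>\<omega>. f (X \<omega>))"
  using assms(2) discrete_rv_borel[OF X, of f] by (intro integrable_const_bound[where B=C]) auto

text \<open>The values of probability zero form a countable set, which can be removed.\<close>

lemma (in prob_space) discrete_rv_AE_atom:
  assumes X: "discrete_rv M X"
  shows "AE \<omega> in M. 0 < prob {\<omega>' \<in> space M. X \<omega>' = X \<omega>}"
proof -
  define N where "N = {a \<in> X ` space M. prob {\<omega>' \<in> space M. X \<omega>' = a} = 0}"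
  have "countable N"
    using X countable_subset[of N] by (auto simp: discrete_rv_def N_def)
  moreover have "AE \<omega> in M. X \<omega> \<noteq> a" if "a \<in> N" for a
    using that discrete_rv_sets[OF X, of "\<lambda>b. b = a"]
    by (intro AE_I[where N="{\<omega> \<in> space M. X \<omega> = a}"]) (auto simp: N_def emeasure_eq_measure)
  ultimately have "AE \<omega> in M. \<forall>a\<in>N. X \<omega> \<noteq> a"
    by (simp add: AE_ball_countable)
  then show ?thesis
    by (rule AE_mp) (auto intro!: AE_I2 simp: N_def zero_less_measure_iff)
qed

text \<open>The law of a discrete random variable is packed as a \<open>pmf\<close>, so that conditional laws can be composed
with \<open>bind_pmf\<close>.\<close>

lemma (in prob_space) discrete_rv_law:
  assumes X: "discrete_rv M X"
  shows "\<exists>\<rho>. measure_pmf \<rho> = distr M (count_space UNIV) X \<and>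
    (\<forall>a. pmf \<rho> a = prob {\<omega> \<in> space M. X \<omega> = a})"
proof -
  let ?D = "distr M (count_space UNIV) X"
  have Xm: "X \<in> M \<rightarrow>\<^sub>M count_space UNIV" using X by (simp add: discrete_rv_def)
  have m: "measure ?D {a} = prob {\<omega> \<in> space M. X \<omega> = a}" for a
    using Xm by (subst measure_distr) (auto simp: vimage_def Int_def conj_commute)
  have "AE a in ?D. measure ?D {a} \<noteq> 0"
    unfolding m using discrete_rv_AE_atom[OF X] Xm
    by (subst AE_distr_iff) (auto elim!: eventually_mono)
  then have *: "measure_pmf (Abs_pmf ?D) = ?D"
    using prob_space_distr[OF Xm] by (intro Abs_pmf_inverse) auto
  show ?thesis
    using * by (auto simp: pmf.rep_eq m intro!: exI[of _ "Abs_pmf ?D"])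
qed

text \<open>Drawing \<open>s\<close> and then \<open>w\<close> from a law that depends on \<open>s\<close>: the chain rule for probabilities.\<close>

lemma pmf_bind_Pair:
  "pmf (bind_pmf \<rho> (\<lambda>s. map_pmf (Pair s) (L s))) (s, w) = pmf \<rho> s * pmf (L s) w"
proof -
  have "pmf (map_pmf (Pair s') (L s')) (s, w) = indicator {s} s' * pmf (L s) w" for s'
  proof (cases "s' = s")
    case True
    have "inj (Pair s :: 'b \<Rightarrow> 'a \<times> 'b)" by (auto intro: injI)
    from pmf_map_inj'[OF this, of "L s" w] True show ?thesis by simp
  next
    case False
    then show ?thesis by (auto simp: pmf_eq_0_set_pmf)
  qed
  then show ?thesis
    by (simp add: pmf_bind) (simp add: pmf.rep_eq)
qed

text \<open>Only values in the support matter, so the bound is required there alone.  This is essential for the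
application: outside the support, a decision may be infeasible and its profit unbounded.\<close>

lemma integral_bind_pmf_bounded:
  fixes f :: "'b \<Rightarrow> real"
  assumes b: "\<And>x. x \<in> set_pmf (bind_pmf p k) \<Longrightarrow> \<bar>f x\<bar> \<le> C"
  shows "measure_pmf.expectation (bind_pmf p k) f = measure_pmf.expectation p (\<lambda>x. measure_pmf.expectation (k x) f)"
proof -
  let ?f = "\<lambda>x. if x \<in> set_pmf (bind_pmf p k) then f x else 0"
  have b': "\<bar>?f x\<bar> \<le> \<bar>C\<bar>" for x
    using order_trans[OF b abs_ge_self] by simp
  have "measure_pmf.expectation (bind_pmf p k) f = measure_pmf.expectation (bind_pmf p k) ?f"
    by (intro integral_cong_AE) (auto simp: AE_measure_pmf_iff)
  also have "\<dots> = measure_pmf.expectation p (\<lambda>x. measure_pmf.expectation (k x) ?f)"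
    unfolding measure_pmf_bind
    by (rule integral_bind[where K="count_space UNIV" and B="\<bar>C\<bar>" and B'=1])
      (use b' in \<open>auto intro!: measure_pmf.finite_measure measure_pmf_in_subprob_space
        simp: measure_pmf.emeasure_space_1\<close>)
  also have "\<dots> = measure_pmf.expectation p (\<lambda>x. measure_pmf.expectation (k x) f)"
    by (intro integral_cong_AE) (auto simp: AE_measure_pmf_iff intro!: integral_cong_AE)
  finally show ?thesis .
qed

lemma abs_pmf_expectation_le:
  fixes f :: "'b \<Rightarrow> real"
  assumes "\<And>x. x \<in> set_pmf p \<Longrightarrow> \<bar>f x\<bar> \<le> C"
  shows "\<bar>measure_pmf.expectation p f\<bar> \<le> C"
proof -
  have i: "integrable p f"
    using assms by (intro measure_pmf.integrable_const_bound[where B=C]) (auto simp: AE_measure_pmf_iff)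
  have "\<bar>measure_pmf.expectation p f\<bar> \<le> measure_pmf.expectation p (\<lambda>x. \<bar>f x\<bar>)" 
    by (rule integral_abs_bound)
  also have "\<dots> \<le> measure_pmf.expectation p (\<lambda>_. C)"
    using assms i by (intro integral_mono_AE) (auto simp: AE_measure_pmf_iff)
  finally show ?thesis by simp
qed

section \<open>A strong law for bounded orthogonal sequences\<close>

text \<open>By monotone convergence the sum of the squares has finite expectation, so it is almost surely finite.\<close>

lemma (in prob_space) AE_tendsto_0_of_summable_second_moments:
  fixes X :: "nat \<Rightarrow> 'a \<Rightarrow> real"
  assumes X: "\<And>n. integrable M (\<lambda>\<omega>. (X n \<omega>)\<^sup>2)" "\<And>n. X n \<in> borel_measurable M"
    and sm: "summable (\<lambda>n. expectation (\<lambda>\<omega>. (X n \<omega>)\<^sup>2))"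
  shows "AE \<omega> in M. (\<lambda>n. X n \<omega>) \<longlonglongrightarrow> 0"
proof -
  note X(2)[measurable]
  have "(\<integral>\<^sup>+\<omega>. (\<Sum>n. ennreal ((X n \<omega>)\<^sup>2)) \<partial>M) = (\<Sum>n. \<integral>\<^sup>+\<omega>. ennreal ((X n \<omega>)\<^sup>2) \<partial>M)"
    by (rule nn_integral_suminf) measurable
  also have "\<dots> = (\<Sum>n. ennreal (expectation (\<lambda>\<omega>. (X n \<omega>)\<^sup>2)))"
    by (intro suminf_cong nn_integral_eq_integral X) auto
  also have "\<dots> = ennreal (\<Sum>n. expectation (\<lambda>\<omega>. (X n \<omega>)\<^sup>2))"
    by (intro suminf_ennreal2 sm) auto
  finally have "(\<integral>\<^sup>+\<omega>. (\<Sum>n. ennreal ((X n \<omega>)\<^sup>2)) \<partial>M) \<noteq> \<infinity>" by simp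
  then have "AE \<omega> in M. (\<Sum>n. ennreal ((X n \<omega>)\<^sup>2)) \<noteq> \<infinity>"
    by (intro nn_integral_PInf_AE) measurable
  then show ?thesis
  proof (rule AE_mp, intro AE_I2 impI)
    fix \<omega> assume "(\<Sum>n. ennreal ((X n \<omega>)\<^sup>2)) \<noteq> \<infinity>"
    then have "summable (\<lambda>n. (X n \<omega>)\<^sup>2)"
      by (intro summable_suminf_not_top) auto
    then have "(\<lambda>n. (X n \<omega>)\<^sup>2) \<longlonglongrightarrow> 0" by (rule summable_LIMSEQ_zero)
    then have "(\<lambda>n. sqrt ((X n \<omega>)\<^sup>2)) \<longlonglongrightarrow> sqrt 0" by (rule tendsto_real_sqrt)
    then show "(\<lambda>n. X n \<omega>) \<longlonglongrightarrow> 0" by (simp add: tendsto_rabs_zero_iff)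
  qed
qed

text \<open>Between \<open>k\<^sup>2\<close> and \<open>(k + 1)\<^sup>2\<close> there are at most \<open>2 * k\<close> further terms, too few to move an average
over more than \<open>k\<^sup>2\<close> of them.\<close>

lemma averages_tendsto_0_from_squares:
  fixes x :: "nat \<Rightarrow> real"
  assumes b: "\<And>n. \<bar>x n\<bar> \<le> C"
    and sq: "(\<lambda>k. (\<Sum>t<k\<^sup>2. x t) / real (k\<^sup>2)) \<longlonglongrightarrow> 0"
  shows "(\<lambda>n. (\<Sum>t<n. x t) / real n) \<longlonglongrightarrow> 0"
proof -
  have C0: "0 \<le> C" using b[of 0] by linarith
  have fs: "filterlim floor_sqrt at_top sequentially"
    unfolding filterlim_at_top eventually_sequentially
    by (meson le_floor_sqrtI)
  let ?u = "\<lambda>k. \<bar>(\<Sum>t<k\<^sup>2. x t) / real (k\<^sup>2)\<bar> + 2 * C / real k"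
  have "?u \<longlonglongrightarrow> \<bar>0\<bar> + 0"
    by (intro tendsto_add tendsto_rabs sq tendsto_divide_0[OF tendsto_const] filterlim_at_top_imp_at_infinity filterlim_real_sequentially)
  then have u0: "(\<lambda>n. ?u (floor_sqrt n)) \<longlonglongrightarrow> 0"
    using filterlim_compose[OF _ fs] by fastforce
  have "\<bar>(\<Sum>t<n. x t) / real n\<bar> \<le> ?u (floor_sqrt n)" if n: "n \<ge> 1" for n
  proof -
    define k where "k = floor_sqrt n"
    have k: "k\<^sup>2 \<le> n" "n < (Suc k)\<^sup>2" "1 \<le> k"
      using n by (auto simp: k_def Suc_floor_sqrt_power2_gt le_floor_sqrt_iff)
    have k2: "n - k\<^sup>2 \<le> 2 * k" using k(1,2) by (auto simp: power2_eq_square)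
    have "{..<n} = {..<k\<^sup>2} \<union> {k\<^sup>2..<n}" using k(1) by auto
    then have "(\<Sum>t<n. x t) = (\<Sum>t<k\<^sup>2. x t) + (\<Sum>t=k\<^sup>2..<n. x t)"
      by (simp add: sum.union_disjoint ivl_disj_int)
    moreover have "\<bar>\<Sum>t=k\<^sup>2..<n. x t\<bar> \<le> (\<Sum>t=k\<^sup>2..<n. C)"
      using b by (intro sum_abs[THEN order_trans] sum_mono)
    moreover have "(\<Sum>t=k\<^sup>2..<n. C) \<le> real (2 * k) * C"
      using k2 C0 by (auto intro!: mult_right_mono simp del: of_nat_mult)
    ultimately have *: "\<bar>\<Sum>t<n. x t\<bar> \<le> \<bar>\<Sum>t<k\<^sup>2. x t\<bar> + 2 * C * real k"
      by (simp add: mult_ac)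
    have "\<bar>(\<Sum>t<n. x t) / real n\<bar> = \<bar>\<Sum>t<n. x t\<bar> / real n" by simp
    also have "\<dots> \<le> (\<bar>\<Sum>t<k\<^sup>2. x t\<bar> + 2 * C * real k) / real (k\<^sup>2)"
      using k n C0 * by (intro frac_le) auto
    also have "\<dots> = ?u k" using k(3) by (simp add: add_divide_distrib power2_eq_square)
    finally show ?thesis by (simp add: k_def)
  qed
  then show ?thesis
    by (intro tendsto_rabs_zero_cancel[OF tendsto_sandwich[OF _ _ tendsto_const u0]])
      (auto simp: eventually_sequentially intro!: exI[of _ 1])
qed

text \<open>Orthogonality makes the second moment of the sum grow only linearly, so the averages at the times
\<open>k\<^sup>2\<close> have summable second moments.\<close>

lemma (in prob_space) bounded_orthogonal_averages:
  fixes X :: "nat \<Rightarrow> 'a \<Rightarrow> real"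
  assumes X[measurable]: "\<And>n. X n \<in> borel_measurable M"
    and b: "\<And>n \<omega>. \<omega> \<in> space M \<Longrightarrow> \<bar>X n \<omega>\<bar> \<le> C"
    and orth: "\<And>m n. m < n \<Longrightarrow> expectation (\<lambda>\<omega>. X m \<omega> * X n \<omega>) = 0"
  shows "AE \<omega> in M. (\<lambda>n. (\<Sum>t<n. X t \<omega>) / real n) \<longlonglongrightarrow> 0"
proof -
  define S where "S n \<omega> = (\<Sum>t<n. X t \<omega>)" for n \<omega>
  have S[measurable]: "S n \<in> borel_measurable M" for n unfolding S_def by measurable
  have bS: "\<bar>S n \<omega>\<bar> \<le> real n * C" if "\<omega> \<in> space M" for n \<omega>
    unfolding S_def using sum_mono[of "{..<n}" "\<lambda>t. \<bar>X t \<omega>\<bar>" "\<lambda>_. C"] b[OF that]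
    by (intro sum_abs[THEN order_trans]) auto
  have C0: "0 \<le> C" using b not_empty by (metis abs_ge_zero all_not_in_conv order_trans)
  have iX: "integrable M (\<lambda>\<omega>. X m \<omega> * X n \<omega>)" for m n
    using b C0 by (intro integrable_const_bound[where B="C * C"] AE_I2) (auto simp: abs_mult intro!: mult_mono)
  have iS: "integrable M (\<lambda>\<omega>. (S n \<omega>)\<^sup>2)" for n
    using bS C0 by (intro integrable_const_bound[where B="(real n * C)\<^sup>2"] AE_I2)
      (auto intro!: power2_le_iff_abs_le[THEN iffD2])
  have ES: "expectation (\<lambda>\<omega>. (S n \<omega>)\<^sup>2) \<le> real n * C\<^sup>2" for n
  proof (induction n)
    case 0
    then show ?case by (simp add: S_def)
  next
    case (Suc n)
    have cross: "expectation (\<lambda>\<omega>. S n \<omega> * X n \<omega>) = 0" "integrable M (\<lambda>\<omega>. S n \<omega> * X n \<omega>)"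
      unfolding S_def sum_distrib_right by (auto simp: iX orth)
    have sq: "expectation (\<lambda>\<omega>. X n \<omega> * X n \<omega>) \<le> expectation (\<lambda>_. C\<^sup>2)"
      using b C0 by (intro integral_mono iX) (auto simp flip: power2_eq_square intro!: power2_le_iff_abs_le[THEN iffD2])
    have "(S (Suc n) \<omega>)\<^sup>2 = (S n \<omega>)\<^sup>2 + 2 * (S n \<omega> * X n \<omega>) + X n \<omega> * X n \<omega>" for \<omega>
      by (simp add: S_def power2_eq_square algebra_simps)
    then have "expectation (\<lambda>\<omega>. (S (Suc n) \<omega>)\<^sup>2) = expectation (\<lambda>\<omega>. (S n \<omega>)\<^sup>2) + expectation (\<lambda>\<omega>. X n \<omega> * X n \<omega>)"
      using iS iX cross by simp
    with Suc.IH sq show ?case by (simp add: algebra_simps prob_space)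
  qed
  have "AE \<omega> in M. (\<lambda>k. S (k\<^sup>2) \<omega> / real (k\<^sup>2)) \<longlonglongrightarrow> 0"
  proof (rule AE_tendsto_0_of_summable_second_moments)
    have "summable (\<lambda>k. C\<^sup>2 * (1 / real k ^ 2))"
      by (intro summable_mult) (use inverse_power_summable[of 2] in \<open>simp add: field_simps\<close>)
    then show "summable (\<lambda>k. expectation (\<lambda>\<omega>. (S (k\<^sup>2) \<omega> / real (k\<^sup>2))\<^sup>2))"
    proof (rule summable_comparison_test'[where N=1])
      fix k :: nat assume k: "1 \<le> k"
      have "expectation (\<lambda>\<omega>. (S (k\<^sup>2) \<omega> / real (k\<^sup>2))\<^sup>2) = expectation (\<lambda>\<omega>. (S (k\<^sup>2) \<omega>)\<^sup>2) / (real (k\<^sup>2))\<^sup>2"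
        by (simp add: power_divide)
      also have "\<dots> \<le> (real (k\<^sup>2) * C\<^sup>2) / (real (k\<^sup>2))\<^sup>2"
        by (intro divide_right_mono ES) auto
      also have "\<dots> = C\<^sup>2 * (1 / real k ^ 2)" using k by (simp add: power2_eq_square)
      finally show "norm (expectation (\<lambda>\<omega>. (S (k\<^sup>2) \<omega> / real (k\<^sup>2))\<^sup>2)) \<le> C\<^sup>2 * (1 / real k ^ 2)"
        by simp
    qed
  qed (use iS in \<open>auto simp: power_divide\<close>)
  then show ?thesis
    by (rule AE_mp) (use b in \<open>auto intro!: AE_I2 averages_tendsto_0_from_squares[where C=C] simp: S_def\<close>)
qed

lemma bounded_over_n_tendsto_0:
  fixes x :: "nat \<Rightarrow> real"
  assumes "\<And>n. \<bar>x n\<bar> \<le> C"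
  shows "(\<lambda>n. x n / real n) \<longlonglongrightarrow> 0"
proof (rule tendsto_rabs_zero_cancel, rule tendsto_sandwich[OF _ _ tendsto_const])
  show "(\<lambda>n. C / real n) \<longlonglongrightarrow> 0"
    by (intro tendsto_divide_0[OF tendsto_const] filterlim_at_top_imp_at_infinity filterlim_real_sequentially)
qed (use assms in \<open>auto intro!: divide_right_mono always_eventually\<close>)

section \<open>Time averages along a Markov chain with finitely many states\<close>

text \<open>\<open>H t\<close> is everything known before slot \<open>t\<close>, \<open>Q t\<close> the current state and \<open>W t\<close> the randomness revealed
during slot \<open>t\<close>.  Given the history, the law of \<open>W t\<close> depends on the current state alone, through \<open>K\<close>.
The history is kept abstract and need only determine the earlier states and randomness, so that it
may contain further data.\<close>

locale controlled_chain = prob_space M for M :: "'w measure" +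
  fixes H :: "nat \<Rightarrow> 'w \<Rightarrow> 'h"
    and W :: "nat \<Rightarrow> 'w \<Rightarrow> 'u"
    and Q :: "nat \<Rightarrow> 'w \<Rightarrow> 'q"
    and state :: "'h \<Rightarrow> 'q"
    and step :: "'q \<Rightarrow> 'u \<Rightarrow> 'q"
    and K :: "'q \<Rightarrow> 'u pmf"
  assumes history_rv: "discrete_rv M (H t)"
    and noise_rv: "discrete_rv M (W t)"
    and state_history: "\<omega> \<in> space M \<Longrightarrow> Q t \<omega> = state (H t \<omega>)"
    and history_records: "s < t \<Longrightarrow> \<exists>u. \<forall>\<omega>\<in>space M. (Q s \<omega>, W s \<omega>) = u (H t \<omega>)"
    and noise_law: "prob {\<omega>\<in>space M. H t \<omega> = h \<and> W t \<omega> = w}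
          = prob {\<omega>\<in>space M. H t \<omega> = h} * pmf (K (state h)) w"
    and state_step: "\<omega> \<in> space M \<Longrightarrow> Q (Suc t) \<omega> = step (Q t \<omega>) (W t \<omega>)"
begin

lemma pair_rv: "discrete_rv M (\<lambda>\<omega>. (H t \<omega>, W t \<omega>))"
  by (intro discrete_rv_Pair history_rv noise_rv)

lemma state_noise_rv: "discrete_rv M (\<lambda>\<omega>. (Q t \<omega>, W t \<omega>))"
  using discrete_rv_compose[OF pair_rv[of t], of "\<lambda>(h, w). (state h, w)"]
  by (subst discrete_rv_cong[where Y="\<lambda>\<omega>. (state (H t \<omega>), W t \<omega>)"]) (auto simp: state_history)

lemma state_rv: "discrete_rv M (Q t)"
  using discrete_rv_compose[OF state_noise_rv[of t], of fst] by simp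

text \<open>The law of the pair of history and new randomness is the composition of the law of the history with
\<open>K\<close>, so Fubini applies.  That \<open>g\<close> may depend on the whole history gives the orthogonality of
martingale differences.\<close>

lemma expectation_given_history:
  fixes g :: "'h \<Rightarrow> 'u \<Rightarrow> real"
  assumes b: "\<And>h w. \<bar>g h w\<bar> \<le> C"
  shows "expectation (\<lambda>\<omega>. g (H t \<omega>) (W t \<omega>))
       = expectation (\<lambda>\<omega>. measure_pmf.expectation (K (Q t \<omega>)) (g (H t \<omega>)))"
proof -
  obtain \<sigma> where \<sigma>: "measure_pmf \<sigma> = distr M (count_space UNIV) (H t)"
      "\<And>h. pmf \<sigma> h = prob {\<omega> \<in> space M. H t \<omega> = h}"
    using discrete_rv_law[OF history_rv[of t]] by blast
  obtain \<tau> where \<tau>: "measure_pmf \<tau> = distr M (count_space UNIV) (\<lambda>\<omega>. (H t \<omega>, W t \<omega>))"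
      "\<And>a. pmf \<tau> a = prob {\<omega> \<in> space M. (H t \<omega>, W t \<omega>) = a}"
    using discrete_rv_law[OF pair_rv[of t]] by blast
  have \<tau>_eq: "\<tau> = bind_pmf \<sigma> (\<lambda>h. map_pmf (Pair h) (K (state h)))"
  proof (rule pmf_eqI)
    fix a :: "'h \<times> 'u"
    obtain h w where a: "a = (h, w)" by (cases a)
    have "{\<omega> \<in> space M. (H t \<omega>, W t \<omega>) = (h, w)} = {\<omega> \<in> space M. H t \<omega> = h \<and> W t \<omega> = w}"
      by auto
    then show "pmf \<tau> a = pmf (bind_pmf \<sigma> (\<lambda>h. map_pmf (Pair h) (K (state h)))) a"
      unfolding a pmf_bind_Pair \<tau>(2) \<sigma>(2) using noise_law by simp
  qed
  have "expectation (\<lambda>\<omega>. g (H t \<omega>) (W t \<omega>)) = measure_pmf.expectation \<tau> (\<lambda>(h, w). g h w)"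
    unfolding \<tau>(1) by (subst integral_distr) (auto intro: discrete_rv_measurable pair_rv)
  also have "\<dots> = measure_pmf.expectation \<sigma> (\<lambda>h. measure_pmf.expectation (K (state h)) (g h))"
    unfolding \<tau>_eq using b by (subst integral_bind_pmf_bounded[where C=C]) auto
  also have "\<dots> = expectation (\<lambda>\<omega>. measure_pmf.expectation (K (state (H t \<omega>))) (g (H t \<omega>)))"
    unfolding \<sigma>(1) by (subst integral_distr) (auto intro: discrete_rv_measurable history_rv)
  also have "\<dots> = expectation (\<lambda>\<omega>. measure_pmf.expectation (K (Q t \<omega>)) (g (H t \<omega>)))"
    by (intro Bochner_Integration.integral_cong) (auto simp: state_history)
  finally show ?thesis .
qed

text \<open>States that occur with positive probability.  Unlike the set of all values of \<open>Q\<close>, this set is closed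
under transitions of positive probability.\<close>

definition reachable :: "'q set" where
  "reachable = {q. \<exists>t. 0 < prob {\<omega> \<in> space M. Q t \<omega> = q}}"

lemma AE_reachable: "AE \<omega> in M. \<forall>t. Q t \<omega> \<in> reachable"
  unfolding AE_all_countable
proof
  show "AE \<omega> in M. Q t \<omega> \<in> reachable" for t
    using discrete_rv_AE_atom[OF state_rv[of t]] by eventually_elim (auto simp: reachable_def)
qed

lemma prob_state_noise:
  "prob {\<omega> \<in> space M. Q t \<omega> = q \<and> W t \<omega> = w} = prob {\<omega> \<in> space M. Q t \<omega> = q} * pmf (K q) w"
proof -
  have ind: "prob {\<omega> \<in> space M. P \<omega>} = expectation (\<lambda>\<omega>. of_bool (P \<omega>))" for P
  proof -
    have "expectation (\<lambda>\<omega>. of_bool (P \<omega>)) = expectation (indicator {\<omega> \<in> space M. P \<omega>} :: _ \<Rightarrow> real)"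
      by (intro Bochner_Integration.integral_cong) auto
    also have "\<dots> = prob ({\<omega> \<in> space M. P \<omega>} \<inter> space M)" by simp
    also have "{\<omega> \<in> space M. P \<omega>} \<inter> space M = {\<omega> \<in> space M. P \<omega>}" by auto
    finally show ?thesis by simp
  qed
  have "prob {\<omega> \<in> space M. Q t \<omega> = q \<and> W t \<omega> = w}
      = expectation (\<lambda>\<omega>. (\<lambda>h w'. of_bool (state h = q) * indicator {w} w') (H t \<omega>) (W t \<omega>))"
    unfolding ind by (intro Bochner_Integration.integral_cong) (auto simp: state_history)
  also have "\<dots> = expectation (\<lambda>\<omega>. of_bool (state (H t \<omega>) = q) * pmf (K (Q t \<omega>)) w)"
    by (subst expectation_given_history[where C=1]) (auto simp: pmf.rep_eq split: split_indicator)
  also have "\<dots> = expectation (\<lambda>\<omega>. of_bool (Q t \<omega> = q) * pmf (K q) w)"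
    by (intro Bochner_Integration.integral_cong) (auto simp: state_history)
  finally show ?thesis by (simp add: ind)
qed

lemma reachable_realised:
  assumes "q \<in> reachable" "w \<in> set_pmf (K q)"
  shows "\<exists>t. 0 < prob {\<omega> \<in> space M. Q t \<omega> = q \<and> W t \<omega> = w}"
proof -
  from assms(1) obtain t where "0 < prob {\<omega> \<in> space M. Q t \<omega> = q}" by (auto simp: reachable_def)
  with assms(2) have "0 < prob {\<omega> \<in> space M. Q t \<omega> = q \<and> W t \<omega> = w}"
    by (simp add: prob_state_noise pmf_positive_iff)
  then show ?thesis ..
qed

text \<open>A property that holds at all points of the sample space transfers in this way to the abstract
transitions of the chain.\<close>

lemma reachable_sample:
  assumes "q \<in> reachable" "w \<in> set_pmf (K q)"
  obtains t \<omega> where "\<omega> \<in> space M" "Q t \<omega> = q" "W t \<omega> = w"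
proof -
  from reachable_realised[OF assms] obtain t where "0 < prob {\<omega> \<in> space M. Q t \<omega> = q \<and> W t \<omega> = w}" ..
  then have "{\<omega> \<in> space M. Q t \<omega> = q \<and> W t \<omega> = w} \<noteq> {}" by (metis less_irrefl measure_empty)
  with that show ?thesis by blast
qed

lemma reachable_step:
  assumes "q \<in> reachable" "w \<in> set_pmf (K q)"
  shows "step q w \<in> reachable"
proof -
  from reachable_realised[OF assms] obtain t where
    "0 < prob {\<omega> \<in> space M. Q t \<omega> = q \<and> W t \<omega> = w}" ..
  also have "\<dots> \<le> prob {\<omega> \<in> space M. Q (Suc t) \<omega> = step q w}"
    by (intro finite_measure_mono discrete_rv_sets state_rv) (auto simp: state_step)
  finally show ?thesis by (auto simp: reachable_def)
qed

definition mean :: "('q \<Rightarrow> 'u \<Rightarrow> real) \<Rightarrow> 'q \<Rightarrow> real" where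
  "mean g q = measure_pmf.expectation (K q) (g q)"

lemma abs_mean_le: "(\<And>q w. \<bar>g q w\<bar> \<le> C) \<Longrightarrow> \<bar>mean g q\<bar> \<le> C"
  unfolding mean_def by (intro abs_pmf_expectation_le)

lemma expectation_mean:
  assumes "\<And>q w. \<bar>g q w\<bar> \<le> C"
  shows "expectation (\<lambda>\<omega>. g (Q t \<omega>) (W t \<omega>)) = expectation (\<lambda>\<omega>. mean g (Q t \<omega>))"
proof -
  have "expectation (\<lambda>\<omega>. g (Q t \<omega>) (W t \<omega>)) = expectation (\<lambda>\<omega>. g (state (H t \<omega>)) (W t \<omega>))"
    by (intro Bochner_Integration.integral_cong) (auto simp: state_history)
  also have "\<dots> = expectation (\<lambda>\<omega>. measure_pmf.expectation (K (Q t \<omega>)) (g (state (H t \<omega>))))"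
    using assms by (intro expectation_given_history[where C=C])
  also have "\<dots> = expectation (\<lambda>\<omega>. mean g (Q t \<omega>))"
    by (intro Bochner_Integration.integral_cong) (auto simp: state_history mean_def)
  finally show ?thesis .
qed

text \<open>An earlier difference is a function of the history, and given the history the later one has mean
zero; so the differences are orthogonal.\<close>

lemma martingale_averages:
  assumes b: "\<And>q w. \<bar>g q w\<bar> \<le> C"
  shows "AE \<omega> in M. (\<lambda>n. (\<Sum>t<n. g (Q t \<omega>) (W t \<omega>) - mean g (Q t \<omega>)) / real n) \<longlonglongrightarrow> 0"
proof (rule bounded_orthogonal_averages[where C="2 * C"])
  let ?d = "\<lambda>q w. g q w - mean g q"
  have d: "\<bar>?d q w\<bar> \<le> 2 * C" for q w
    using b[of q w] abs_mean_le[of g C q, OF b] by linarith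
  then show "\<bar>?d (Q n \<omega>) (W n \<omega>)\<bar> \<le> 2 * C" for n \<omega> .
  show "(\<lambda>\<omega>. ?d (Q n \<omega>) (W n \<omega>)) \<in> borel_measurable M" for n
    using discrete_rv_borel[OF state_noise_rv[of n], of "\<lambda>(q, w). ?d q w"] by simp
  fix m n :: nat assume "m < n"
  then obtain u where u: "\<And>\<omega>. \<omega> \<in> space M \<Longrightarrow> (Q m \<omega>, W m \<omega>) = u (H n \<omega>)"
    using history_records by blast
  define v where "v h = (case u h of (q, w) \<Rightarrow> ?d q w)" for h
  have v: "\<bar>v h\<bar> \<le> 2 * C" for h using d by (auto simp: v_def split: prod.split)
  have "expectation (\<lambda>\<omega>. ?d (Q m \<omega>) (W m \<omega>) * ?d (Q n \<omega>) (W n \<omega>))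
      = expectation (\<lambda>\<omega>. v (H n \<omega>) * ?d (state (H n \<omega>)) (W n \<omega>))"
    by (intro Bochner_Integration.integral_cong) (auto simp: v_def u[symmetric] state_history[symmetric])
  also have "\<dots> = expectation (\<lambda>\<omega>. measure_pmf.expectation (K (Q n \<omega>)) (\<lambda>w. v (H n \<omega>) * ?d (state (H n \<omega>)) w))"
  proof (rule expectation_given_history)
    show "\<bar>v h * ?d (state h) w\<bar> \<le> 2 * C * (2 * C)" for h w
      unfolding abs_mult by (intro mult_mono' v d abs_ge_zero)
  qed
  also have "\<dots> = expectation (\<lambda>\<omega>. 0)"
  proof (intro Bochner_Integration.integral_cong refl)
    fix \<omega> assume \<omega>: "\<omega> \<in> space M"
    have "integrable (K (Q n \<omega>)) (g (Q n \<omega>))"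
      using b by (intro measure_pmf.integrable_const_bound[where B=C]) auto
    then show "measure_pmf.expectation (K (Q n \<omega>)) (\<lambda>w. v (H n \<omega>) * ?d (state (H n \<omega>)) w) = 0"
      by (simp add: state_history[OF \<omega>, symmetric] mean_def)
  qed
  finally show "expectation (\<lambda>\<omega>. ?d (Q m \<omega>) (W m \<omega>) * ?d (Q n \<omega>) (W n \<omega>)) = 0" by simp
qed

text \<open>The transition operator of the chain.\<close>

definition transfer :: "('q \<Rightarrow> real) \<Rightarrow> 'q \<Rightarrow> real" where
  "transfer f = mean (\<lambda>q w. f (step q w))"

lemma abs_transfer_le: "(\<And>q. \<bar>f q\<bar> \<le> C) \<Longrightarrow> \<bar>transfer f q\<bar> \<le> C"
  unfolding transfer_def by (intro abs_mean_le)

lemma abs_transfer_power_le: "(\<And>q. \<bar>f q\<bar> \<le> C) \<Longrightarrow> \<bar>(transfer ^^ k) f q\<bar> \<le> C"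
  by (induction k arbitrary: q) (auto intro: abs_transfer_le)

text \<open>Shifting the time by one slot changes the sum by two bounded terms, and the value after the shift
differs from its conditional mean by a martingale difference.\<close>

lemma averages_transfer:
  assumes b: "\<And>q. \<bar>f q\<bar> \<le> C"
  shows "AE \<omega> in M. (\<lambda>n. (\<Sum>t<n. f (Q t \<omega>) - transfer f (Q t \<omega>)) / real n) \<longlonglongrightarrow> 0"
  using martingale_averages[of "\<lambda>q w. f (step q w)" C, OF b]
proof (rule AE_mp, intro AE_I2 impI)
  fix \<omega> assume \<omega>: "\<omega> \<in> space M"
    and lim: "(\<lambda>n. (\<Sum>t<n. f (step (Q t \<omega>) (W t \<omega>)) - mean (\<lambda>q w. f (step q w)) (Q t \<omega>)) / real n) \<longlonglongrightarrow> 0"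
  have tele: "(\<Sum>t<n. f (Q t \<omega>) - f (Q (Suc t) \<omega>)) = f (Q 0 \<omega>) - f (Q n \<omega>)" for n
    by (rule sum_lessThan_telescope')
  have "(\<lambda>n. (f (Q 0 \<omega>) - f (Q n \<omega>)) / real n) \<longlonglongrightarrow> 0"
  proof (rule bounded_over_n_tendsto_0)
    show "\<bar>f (Q 0 \<omega>) - f (Q n \<omega>)\<bar> \<le> 2 * C" for n
      using b[of "Q 0 \<omega>"] b[of "Q n \<omega>"] by linarith
  qed
  from tendsto_add[OF this lim]
  show "(\<lambda>n. (\<Sum>t<n. f (Q t \<omega>) - transfer f (Q t \<omega>)) / real n) \<longlonglongrightarrow> 0"
    unfolding tele[symmetric] state_step[OF \<omega>] transfer_def add_divide_distrib[symmetric] sum.distrib[symmetric]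
    by simp
qed

lemma averages_transfer_power:
  assumes b: "\<And>q. \<bar>f q\<bar> \<le> C"
  shows "AE \<omega> in M. (\<lambda>n. (\<Sum>t<n. f (Q t \<omega>) - (transfer ^^ k) f (Q t \<omega>)) / real n) \<longlonglongrightarrow> 0"
proof (induction k)
  case 0
  then show ?case by simp
next
  case (Suc k)
  have "AE \<omega> in M. (\<lambda>n. (\<Sum>t<n. (transfer ^^ k) f (Q t \<omega>) - transfer ((transfer ^^ k) f) (Q t \<omega>)) / real n) \<longlonglongrightarrow> 0"
    using b by (intro averages_transfer[where C=C] abs_transfer_power_le)
  with Suc.IH show ?case
  proof eventually_elim
    case (elim \<omega>)
    from tendsto_add[OF elim] show ?case by (simp flip: add_divide_distrib sum.distrib)
  qed
qed

definition cesaro :: "nat \<Rightarrow> ('q \<Rightarrow> real) \<Rightarrow> 'q \<Rightarrow> real" where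
  "cesaro n f q = (\<Sum>k<n. (transfer ^^ k) f q) / real n"

lemma abs_cesaro_le:
  assumes b: "\<And>q. \<bar>f q\<bar> \<le> C"
  shows "\<bar>cesaro n f q\<bar> \<le> C"
proof (cases "n = 0")
  case False
  have "\<bar>\<Sum>k<n. (transfer ^^ k) f q\<bar> \<le> (\<Sum>k<n. C)"
    using abs_transfer_power_le[of f C, OF b] by (intro sum_abs[THEN order_trans] sum_mono)
  with False show ?thesis by (simp add: cesaro_def field_simps)
qed (use b[of q] in \<open>auto simp: cesaro_def\<close>)

lemma averages_cesaro:
  assumes b: "\<And>q. \<bar>f q\<bar> \<le> C" and n: "0 < n"
  shows "AE \<omega> in M. (\<lambda>N. (\<Sum>t<N. f (Q t \<omega>) - cesaro n f (Q t \<omega>)) / real N) \<longlonglongrightarrow> 0"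
proof -
  have "AE \<omega> in M. \<forall>k. (\<lambda>N. (\<Sum>t<N. f (Q t \<omega>) - (transfer ^^ k) f (Q t \<omega>)) / real N) \<longlonglongrightarrow> 0"
    unfolding AE_all_countable using averages_transfer_power[of f C, OF b] by blast
  then show ?thesis
  proof eventually_elim
    case (elim \<omega>)
    have "(\<lambda>N. (1 / real n) * (\<Sum>k<n. (\<Sum>t<N. f (Q t \<omega>) - (transfer ^^ k) f (Q t \<omega>)) / real N)) \<longlonglongrightarrow> (1 / real n) * (\<Sum>k<n. 0)"
      using elim by (intro tendsto_mult tendsto_sum tendsto_const) auto
    moreover have "(1 / real n) * (\<Sum>k<n. (\<Sum>t<N. f (Q t \<omega>) - (transfer ^^ k) f (Q t \<omega>)) / real N)
        = (\<Sum>t<N. f (Q t \<omega>) - cesaro n f (Q t \<omega>)) / real N" for N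
    proof -
      have "f q - cesaro n f q = (1 / real n) * (\<Sum>k<n. f q - (transfer ^^ k) f q)" for q
        using n by (simp add: cesaro_def sum_subtractf field_simps)
      then show ?thesis
        by (simp add: sum.swap[of _ "{..<n}"] flip: sum_divide_distrib sum_distrib_left)
    qed
    ultimately show ?case by simp
  qed
qed

text \<open>The sum telescopes, so the operator moves a Cesaro mean by \<open>O(1 / n)\<close> only.\<close>

lemma transfer_cesaro:
  assumes b: "\<And>q. \<bar>f q\<bar> \<le> C"
  shows "transfer (cesaro n f) q - cesaro n f q = ((transfer ^^ n) f q - f q) / real n"
proof -
  define F where "F k = (transfer ^^ k) f" for k
  have "integrable (K q) (\<lambda>w. F k (step q w))" for k
    unfolding F_def using abs_transfer_power_le[of f C, OF b]
    by (intro measure_pmf.integrable_const_bound[where B=C]) auto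
  then have "transfer (cesaro n f) q = (\<Sum>k<n. transfer (F k) q) / real n"
    by (simp add: transfer_def mean_def cesaro_def F_def[symmetric])
  moreover have "transfer (F k) = F (Suc k)" for k by (simp add: F_def)
  ultimately have "transfer (cesaro n f) q - cesaro n f q = (\<Sum>k<n. F (Suc k) q - F k q) / real n"
    by (simp add: cesaro_def F_def[symmetric] sum_subtractf diff_divide_distrib)
  also have "(\<Sum>k<n. F (Suc k) q - F k q) = F n q - F 0 q"
    by (rule sum_lessThan_telescope)
  finally show ?thesis by (simp add: F_def)
qed

text \<open>Compactness of a finite-dimensional box yields a limit point of the Cesaro means, and the Cesaro means
are almost invariant by \<open>transfer_cesaro\<close>, so the limit point is invariant.\<close>

lemma harmonic_limit:
  assumes fin: "finite reachable" and b: "\<And>q. \<bar>f q\<bar> \<le> C"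
  shows "\<exists>h (r :: nat \<Rightarrow> nat). strict_mono r \<and> (\<forall>q. \<bar>h q\<bar> \<le> C) \<and>
    (\<forall>q\<in>reachable. transfer h q = h q) \<and>
    (\<forall>e>0. \<forall>\<^sub>F n in sequentially. \<forall>q\<in>reachable. \<bar>cesaro (r n) f q - h q\<bar> < e)"
proof -
  have "bounded ((\<lambda>x. x q) ` range (\<lambda>n. cesaro n f))" for q
    using abs_cesaro_le[of f C, OF b] by (auto simp: bounded_iff)
  then have "\<exists>l r. strict_mono (r :: nat \<Rightarrow> nat) \<and>
      (\<forall>e>0. \<forall>\<^sub>F n in sequentially. \<forall>q\<in>reachable. dist (cesaro (r n) f q) (l q) < e)"
    using compact_lemma_general[OF fin, of "\<lambda>x q. x q" "\<lambda>n. cesaro n f" "\<lambda>x. x"] by blast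
  then obtain l and r :: "nat \<Rightarrow> nat" where r: "strict_mono r"
    and l: "\<And>e. 0 < e \<Longrightarrow> \<forall>\<^sub>F n in sequentially. \<forall>q\<in>reachable. dist (cesaro (r n) f q) (l q) < e"
    by blast
  \<comment> \<open>Off the reachable set the limit point is arbitrary; zero keeps the bound.\<close>
  define h where "h q = (if q \<in> reachable then l q else 0)" for q
  have lim: "(\<lambda>n. cesaro (r n) f q) \<longlonglongrightarrow> h q" if "q \<in> reachable" for q
    using that by (auto simp: h_def intro!: tendstoI elim!: eventually_mono dest!: l)
  have C0: "0 \<le> C" using b abs_ge_zero order_trans by blast
  have hC: "\<bar>h q\<bar> \<le> C" for q
  proof (cases "q \<in> reachable")
    case True
    show ?thesis
      by (rule LIMSEQ_le_const2[OF tendsto_rabs[OF lim[OF True]]]) (use abs_cesaro_le[of f C, OF b] in auto)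
  qed (use C0 in \<open>simp add: h_def\<close>)
  have "transfer h q = h q" if q: "q \<in> reachable" for q
  proof -
    have 1: "(\<lambda>n. transfer (cesaro (r n) f) q) \<longlonglongrightarrow> transfer h q"
      unfolding transfer_def mean_def
    proof (rule integral_dominated_convergence[where w="\<lambda>_. C"])
      show "AE w in K q. (\<lambda>n. cesaro (r n) f (step q w)) \<longlonglongrightarrow> h (step q w)"
        using lim reachable_step[OF q] by (auto simp: AE_measure_pmf_iff)
    qed (use abs_cesaro_le[of f C, OF b] in auto)
    have "(\<lambda>n. ((transfer ^^ n) f q - f q) / real n) \<longlonglongrightarrow> 0"
    proof (rule bounded_over_n_tendsto_0)
      show "\<bar>(transfer ^^ n) f q - f q\<bar> \<le> 2 * C" for n
        using abs_transfer_power_le[of f C n q, OF b] b[of q] by linarith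
    qed
    from LIMSEQ_subseq_LIMSEQ[OF this r]
    have "(\<lambda>n. transfer (cesaro (r n) f) q - cesaro (r n) f q) \<longlonglongrightarrow> 0"
      using transfer_cesaro[of f C, OF b] by (simp add: o_def)
    from LIMSEQ_unique[OF this tendsto_diff[OF 1 lim[OF q]]] show ?thesis by simp
  qed
  moreover have "\<forall>\<^sub>F n in sequentially. \<forall>q\<in>reachable. \<bar>cesaro (r n) f q - h q\<bar> < e" if "0 < e" for e
    using l[OF that] by (simp add: h_def dist_real_def)
  ultimately show ?thesis using r hC by (intro exI[of _ h] exI[of _ r]) simp
qed

text \<open>Along the chain, \<open>h\<close> is a bounded martingale.  Its increments are orthogonal to its past values, so
the second moments of the increments add up to at most a bound of the second moment of \<open>h\<close>.
The increments therefore tend to zero, and as they take only finitely many values, they vanish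
eventually.\<close>

lemma harmonic_eventually_constant:
  assumes fin: "finite reachable" and b: "\<And>q. \<bar>h q\<bar> \<le> C"
    and harm: "\<And>q. q \<in> reachable \<Longrightarrow> transfer h q = h q"
  shows "AE \<omega> in M. \<exists>l. \<forall>\<^sub>F t in sequentially. h (Q t \<omega>) = l"
proof -
  define D where "D t \<omega> = h (Q (Suc t) \<omega>) - h (Q t \<omega>)" for t \<omega>
  have [measurable]: "(\<lambda>\<omega>. h (Q t \<omega>)) \<in> borel_measurable M" for t
    by (rule discrete_rv_borel[OF state_rv])
  have C0: "0 \<le> C" using b abs_ge_zero order_trans by blast
  have i: "integrable M (\<lambda>\<omega>. h (Q s \<omega>) * h (Q t \<omega>))" for s t
    using b C0 by (intro integrable_const_bound[where B="C * C"]) (auto simp: abs_mult intro!: mult_mono)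
  \<comment> \<open>Harmonicity: the mixed moment equals the second moment at the earlier time.\<close>
  have cross: "expectation (\<lambda>\<omega>. h (Q (Suc t) \<omega>) * h (Q t \<omega>)) = expectation (\<lambda>\<omega>. h (Q t \<omega>) * h (Q t \<omega>))" for t
  proof -
    have "expectation (\<lambda>\<omega>. h (Q (Suc t) \<omega>) * h (Q t \<omega>))
        = expectation (\<lambda>\<omega>. (\<lambda>q w. h (step q w) * h q) (Q t \<omega>) (W t \<omega>))"
      by (intro Bochner_Integration.integral_cong) (auto simp: state_step)
    also have "\<dots> = expectation (\<lambda>\<omega>. mean (\<lambda>q w. h (step q w) * h q) (Q t \<omega>))"
      by (rule expectation_mean[where C="C * C"]) (use b C0 in \<open>auto simp: abs_mult intro!: mult_mono\<close>)
    also have "\<dots> = expectation (\<lambda>\<omega>. h (Q t \<omega>) * h (Q t \<omega>))"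
    proof (rule integral_cong_AE)
      show "AE \<omega> in M. mean (\<lambda>q w. h (step q w) * h q) (Q t \<omega>) = h (Q t \<omega>) * h (Q t \<omega>)"
        using AE_reachable
      proof eventually_elim
        case (elim \<omega>)
        with harm[of "Q t \<omega>"] show ?case by (simp add: mean_def transfer_def)
      qed
    qed (auto intro: discrete_rv_borel[OF state_rv])
    finally show ?thesis .
  qed
  have D2: "(D t \<omega>)\<^sup>2 = h (Q (Suc t) \<omega>) * h (Q (Suc t) \<omega>) - 2 * (h (Q (Suc t) \<omega>) * h (Q t \<omega>)) + h (Q t \<omega>) * h (Q t \<omega>)" for t \<omega>
    by (simp add: D_def power2_eq_square algebra_simps)
  have iD: "integrable M (\<lambda>\<omega>. (D t \<omega>)\<^sup>2)" for t
    unfolding D2 by (intro Bochner_Integration.integrable_add Bochner_Integration.integrable_diff integrable_mult_right i)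
  have ED: "expectation (\<lambda>\<omega>. (D t \<omega>)\<^sup>2) = expectation (\<lambda>\<omega>. h (Q (Suc t) \<omega>) * h (Q (Suc t) \<omega>))
      - expectation (\<lambda>\<omega>. h (Q t \<omega>) * h (Q t \<omega>))" for t
    unfolding D2 using i by (simp add: cross)
  have "AE \<omega> in M. (\<lambda>t. D t \<omega>) \<longlonglongrightarrow> 0"
  proof (rule AE_tendsto_0_of_summable_second_moments[OF iD])
    show "summable (\<lambda>t. expectation (\<lambda>\<omega>. (D t \<omega>)\<^sup>2))"
    proof (rule summableI_nonneg_bounded)
      fix n
      have "(\<Sum>t<n. expectation (\<lambda>\<omega>. (D t \<omega>)\<^sup>2)) = expectation (\<lambda>\<omega>. h (Q n \<omega>) * h (Q n \<omega>)) - expectation (\<lambda>\<omega>. h (Q 0 \<omega>) * h (Q 0 \<omega>))"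
        unfolding ED by (rule sum_lessThan_telescope)
      also have "\<dots> \<le> expectation (\<lambda>\<omega>. C * C) - 0"
      proof (intro diff_mono integral_mono i Bochner_Integration.integral_nonneg)
        show "h (Q n \<omega>) * h (Q n \<omega>) \<le> C * C" for \<omega>
          using mult_mono'[OF b b abs_ge_zero abs_ge_zero, of "Q n \<omega>" "Q n \<omega>"] by simp
      qed auto
      finally show "(\<Sum>t<n. expectation (\<lambda>\<omega>. (D t \<omega>)\<^sup>2)) \<le> C * C" by (simp add: prob_space)
    qed simp
  qed (simp add: D_def)
  then show ?thesis
    using AE_reachable
  proof eventually_elim
    case (elim \<omega>)
    \<comment> \<open>The nonzero distances between values of \<open>h\<close> are bounded away from zero.\<close>
    define F where "F = (\<lambda>(p, q). \<bar>h p - h q\<bar>) ` (reachable \<times> reachable) - {0}"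
    have F: "finite F" using fin by (simp add: F_def)
    have "\<exists>d>0. \<forall>x\<in>F. d \<le> x"
    proof (cases "F = {}")
      case False
      with F have "0 < Min F" by (auto simp: F_def)
      with F show ?thesis by (intro exI[of _ "Min F"]) auto
    qed (auto intro: exI[of _ 1])
    then obtain d where d: "0 < d" "\<And>x. x \<in> F \<Longrightarrow> d \<le> x" by blast
    from elim(1) d(1) have "\<forall>\<^sub>F t in sequentially. \<bar>D t \<omega>\<bar> < d"
      by (auto dest!: tendstoD[of _ _ _ d])
    then obtain N where N: "\<And>t. N \<le> t \<Longrightarrow> \<bar>D t \<omega>\<bar> < d"
      by (auto simp: eventually_sequentially)
    have st: "h (Q (Suc t) \<omega>) = h (Q t \<omega>)" if "N \<le> t" for t
    proof (rule ccontr)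
      assume "\<not> ?thesis"
      then have "\<bar>D t \<omega>\<bar> \<in> F" using elim(2) by (auto simp: F_def D_def)
      with d(2) N[OF that] show False by fastforce
    qed
    have "h (Q t \<omega>) = h (Q N \<omega>)" if "N \<le> t" for t
      using that by (induction t rule: dec_induct) (auto simp: st)
    then show ?case by (auto simp: eventually_sequentially)
  qed
qed

text \<open>The averages of \<open>f\<close> have the same limiting behaviour as those of a Cesaro mean, which is uniformly
close to \<open>h\<close>; and the averages of \<open>h\<close> converge because \<open>h\<close> is eventually constant along the path.\<close>

lemma state_averages_converge:
  assumes fin: "finite reachable" and b: "\<And>q. \<bar>f q\<bar> \<le> C"
  shows "AE \<omega> in M. \<exists>l. (\<lambda>n. (\<Sum>t<n. f (Q t \<omega>)) / real n) \<longlonglongrightarrow> l"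
proof -
  obtain h and r :: "nat \<Rightarrow> nat" where r: "strict_mono r" and hC: "\<forall>q. \<bar>h q\<bar> \<le> C"
    and harm: "\<forall>q\<in>reachable. transfer h q = h q"
    and close: "\<forall>e>0. \<forall>\<^sub>F n in sequentially. \<forall>q\<in>reachable. \<bar>cesaro (r n) f q - h q\<bar> < e"
    using harmonic_limit[of f C, OF fin b] by blast
  have const: "AE \<omega> in M. \<exists>l. \<forall>\<^sub>F t in sequentially. h (Q t \<omega>) = l"
    using hC harm by (intro harmonic_eventually_constant[where C=C] fin) auto
  have "AE \<omega> in M. \<forall>n. 0 < n \<longrightarrow> (\<lambda>N. (\<Sum>t<N. f (Q t \<omega>) - cesaro n f (Q t \<omega>)) / real N) \<longlonglongrightarrow> 0"
    unfolding AE_all_countable using averages_cesaro[of f C, OF b] by auto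
  then show ?thesis
    using const AE_reachable
  proof eventually_elim
    case (elim \<omega>)
    then obtain l N0 where l: "\<And>t. N0 \<le> t \<Longrightarrow> h (Q t \<omega>) = l" by (auto simp: eventually_sequentially)
    have 3: "(\<lambda>N. (\<Sum>t<N. h (Q t \<omega>) - l) / real N) \<longlonglongrightarrow> 0"
    proof (rule bounded_over_n_tendsto_0)
      show "\<bar>\<Sum>t<N. h (Q t \<omega>) - l\<bar> \<le> (\<Sum>t<N0. \<bar>h (Q t \<omega>) - l\<bar>)" for N
      proof -
        have "(\<Sum>t<N. h (Q t \<omega>) - l) = (\<Sum>t\<in>{..<N} \<inter> {..<N0}. h (Q t \<omega>) - l)"
          using l by (intro sum.mono_neutral_right) (auto, meson not_le)
        also have "\<bar>\<dots>\<bar> \<le> (\<Sum>t\<in>{..<N} \<inter> {..<N0}. \<bar>h (Q t \<omega>) - l\<bar>)" by (rule sum_abs)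
        also have "\<dots> \<le> (\<Sum>t<N0. \<bar>h (Q t \<omega>) - l\<bar>)" by (intro sum_mono2) auto
        finally show ?thesis .
      qed
    qed
    have "(\<lambda>n. (\<Sum>t<n. f (Q t \<omega>)) / real n) \<longlonglongrightarrow> l"
    proof (rule tendstoI)
      fix e :: real assume e: "0 < e"
      have "\<forall>\<^sub>F n in sequentially. 0 < r n \<and> (\<forall>q\<in>reachable. \<bar>cesaro (r n) f q - h q\<bar> < e / 3)"
      proof (rule eventually_conj)
        show "\<forall>\<^sub>F n in sequentially. 0 < r n"
          using eventually_gt_at_top[of 0] by eventually_elim (use less_le_trans[OF _ seq_suble[OF r]] in blast)
      qed (rule close[rule_format], use e in simp)
      then obtain n where n: "0 < n" "\<And>q. q \<in> reachable \<Longrightarrow> \<bar>cesaro n f q - h q\<bar> < e / 3"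
        by (auto simp: eventually_sequentially)
      have 1: "(\<lambda>N. (\<Sum>t<N. f (Q t \<omega>) - cesaro n f (Q t \<omega>)) / real N) \<longlonglongrightarrow> 0"
        using elim(1) n(1) by blast
      have "\<forall>\<^sub>F N in sequentially. \<bar>(\<Sum>t<N. f (Q t \<omega>) - cesaro n f (Q t \<omega>)) / real N\<bar> < e / 3"
        using tendstoD[OF 1, of "e / 3"] e by simp
      moreover have "\<forall>\<^sub>F N in sequentially. \<bar>(\<Sum>t<N. h (Q t \<omega>) - l) / real N\<bar> < e / 3"
        using tendstoD[OF 3, of "e / 3"] e by simp
      ultimately show "\<forall>\<^sub>F N in sequentially. dist ((\<Sum>t<N. f (Q t \<omega>)) / real N) l < e"
        using eventually_gt_at_top[of 0]
      proof eventually_elim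
        case (elim N)
        have "\<bar>\<Sum>t<N. cesaro n f (Q t \<omega>) - h (Q t \<omega>)\<bar> \<le> (\<Sum>t<N. e / 3)"
          using n(2) \<open>\<forall>t. Q t \<omega> \<in> reachable\<close>
          by (intro sum_abs[THEN order_trans] sum_mono less_imp_le) auto
        then have 2: "\<bar>(\<Sum>t<N. cesaro n f (Q t \<omega>) - h (Q t \<omega>)) / real N\<bar> \<le> e / 3"
          using elim(3) by (simp add: field_simps)
        have "(\<Sum>t<N. f (Q t \<omega>)) / real N - l = (\<Sum>t<N. f (Q t \<omega>) - cesaro n f (Q t \<omega>)) / real N
            + (\<Sum>t<N. cesaro n f (Q t \<omega>) - h (Q t \<omega>)) / real N + (\<Sum>t<N. h (Q t \<omega>) - l) / real N"
          using elim(3) by (simp add: sum_subtractf field_simps)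
        with 2 elim(1,2) show ?case unfolding dist_real_def by linarith
      qed
    qed
    then show ?case ..
  qed
qed

text \<open>A bound along all paths suffices: setting \<open>g\<close> to zero where the bound fails changes neither its values
along a path nor its conditional means at reachable states.\<close>

lemma truncation:
  assumes b: "\<And>t \<omega>. \<omega> \<in> space M \<Longrightarrow> \<bar>g (Q t \<omega>) (W t \<omega>)\<bar> \<le> C"
  obtains g' where "\<And>q w. \<bar>g' q w\<bar> \<le> C"
    "\<And>t \<omega>. \<omega> \<in> space M \<Longrightarrow> g' (Q t \<omega>) (W t \<omega>) = g (Q t \<omega>) (W t \<omega>)"
    "\<And>q. q \<in> reachable \<Longrightarrow> mean g' q = mean g q"
proof
  let ?g = "\<lambda>q w. if \<bar>g q w\<bar> \<le> C then g q w else 0"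
  have "0 \<le> C" using b not_empty abs_ge_zero by (metis all_not_in_conv order_trans)
  then show "\<bar>?g q w\<bar> \<le> C" for q w by simp
  show "?g (Q t \<omega>) (W t \<omega>) = g (Q t \<omega>) (W t \<omega>)" if "\<omega> \<in> space M" for t \<omega>
    using b[OF that] by simp
  show "mean ?g q = mean g q" if q: "q \<in> reachable" for q
    unfolding mean_def
  proof (intro integral_cong_AE)
    have "\<bar>g q w\<bar> \<le> C" if "w \<in> set_pmf (K q)" for w
      using reachable_sample[OF q that] b by metis
    then show "AE w in K q. ?g q w = g q w" by (auto simp: AE_measure_pmf_iff)
  qed auto
qed

theorem expectation_ge:
  assumes b: "\<And>t \<omega>. \<omega> \<in> space M \<Longrightarrow> \<bar>g (Q t \<omega>) (W t \<omega>)\<bar> \<le> C"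
    and ge: "\<And>q. q \<in> reachable \<Longrightarrow> c \<le> mean g q"
  shows "c \<le> expectation (\<lambda>\<omega>. g (Q t \<omega>) (W t \<omega>))"
proof -
  obtain g' where g': "\<And>q w. \<bar>g' q w\<bar> \<le> C"
    "\<And>t \<omega>. \<omega> \<in> space M \<Longrightarrow> g' (Q t \<omega>) (W t \<omega>) = g (Q t \<omega>) (W t \<omega>)"
    "\<And>q. q \<in> reachable \<Longrightarrow> mean g' q = mean g q"
    using truncation[of g C, OF b] by blast
  have "expectation (\<lambda>_. c) \<le> expectation (\<lambda>\<omega>. mean g' (Q t \<omega>))"
  proof (intro integral_mono_AE)
    show "integrable M (\<lambda>\<omega>. mean g' (Q t \<omega>))"
      by (rule discrete_rv_integrable[OF state_rv, where C=C]) (simp add: abs_mean_le g'(1))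
    show "AE \<omega> in M. c \<le> mean g' (Q t \<omega>)"
      using AE_reachable by eventually_elim (use ge g'(3) in auto)
  qed simp
  also have "\<dots> = expectation (\<lambda>\<omega>. g' (Q t \<omega>) (W t \<omega>))"
    by (rule expectation_mean[of g' C, symmetric, OF g'(1)])
  also have "\<dots> = expectation (\<lambda>\<omega>. g (Q t \<omega>) (W t \<omega>))"
    by (intro Bochner_Integration.integral_cong) (auto simp: g'(2))
  finally show ?thesis by (simp add: prob_space)
qed

theorem time_averages_converge_ge:
  assumes fin: "finite reachable"
    and b: "\<And>t \<omega>. \<omega> \<in> space M \<Longrightarrow> \<bar>g (Q t \<omega>) (W t \<omega>)\<bar> \<le> C"
    and ge: "\<And>q. q \<in> reachable \<Longrightarrow> c \<le> mean g q"
  shows "AE \<omega> in M. \<exists>l. (\<lambda>n. (\<Sum>t<n. g (Q t \<omega>) (W t \<omega>)) / real n) \<longlonglongrightarrow> l \<and> c \<le> l"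
proof -
  obtain g' where g': "\<And>q w. \<bar>g' q w\<bar> \<le> C"
    "\<And>t \<omega>. \<omega> \<in> space M \<Longrightarrow> g' (Q t \<omega>) (W t \<omega>) = g (Q t \<omega>) (W t \<omega>)"
    "\<And>q. q \<in> reachable \<Longrightarrow> mean g' q = mean g q"
    using truncation[of g C, OF b] by blast
  have bm: "\<bar>mean g' q\<bar> \<le> C" for q by (intro abs_mean_le g'(1))
  show ?thesis
    using martingale_averages[of g' C, OF g'(1)] state_averages_converge[of "mean g'" C, OF fin bm] AE_reachable AE_space
  proof eventually_elim
    case (elim \<omega>)
    then obtain l where l: "(\<lambda>n. (\<Sum>t<n. mean g' (Q t \<omega>)) / real n) \<longlonglongrightarrow> l" by blast
    from tendsto_add[OF elim(1) l]
    have 1: "(\<lambda>n. (\<Sum>t<n. g (Q t \<omega>) (W t \<omega>)) / real n) \<longlonglongrightarrow> l"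
      by (simp add: g'(2)[OF elim(4)] flip: add_divide_distrib sum.distrib)
    have "c \<le> (\<Sum>t<n. mean g' (Q t \<omega>)) / real n" if "1 \<le> n" for n
    proof -
      have "(\<Sum>t<n. c) \<le> (\<Sum>t<n. mean g' (Q t \<omega>))"
        using ge g'(3) elim(3) by (intro sum_mono) auto
      with that show ?thesis by (simp add: field_simps)
    qed
    then have "c \<le> l" by (intro LIMSEQ_le_const[OF l] exI[of _ 1]) auto
    with 1 show ?case by blast
  qed
qed

end

section \<open>The plant: feasible decisions and thresholds\<close>

text \<open>This links the infinite sums in the definition of the optimal profit to expectations.\<close>

lemma pmf_expectation_eq_infsum:
  fixes f :: "'a \<Rightarrow> real"
  assumes b: "\<And>x. x \<in> set_pmf p \<Longrightarrow> \<bar>f x\<bar> \<le> C" and A: "set_pmf p \<subseteq> A"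
  shows "measure_pmf.expectation p f = (\<Sum>\<^sub>\<infinity>x\<in>A. pmf p x * f x)"
proof -
  have "Infinite_Set_Sum.abs_summable_on (\<lambda>x. pmf p x * C) UNIV"
    by (intro abs_summable_on_cmult_left pmf_abs_summable)
  then have "Infinite_Set_Sum.abs_summable_on (\<lambda>x. pmf p x * f x) UNIV"
  proof (rule abs_summable_on_comparison_test)
    show "norm (pmf p x * f x) \<le> norm (pmf p x * C)" for x
    proof (cases "x \<in> set_pmf p")
      case True
      from order_trans[OF b[OF this] abs_ge_self] show ?thesis by (simp add: abs_mult mult_left_mono)
    qed (simp add: set_pmf_iff)
  qed
  then have "measure_pmf.expectation p f = (\<Sum>\<^sub>\<infinity>x\<in>UNIV. pmf p x * f x)"
    by (simp add: pmf_expectation_eq_infsetsum infsetsum_infsum)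
  also have "\<dots> = (\<Sum>\<^sub>\<infinity>x\<in>A. pmf p x * f x)"
    using A by (intro infsum_cong_neutral) (auto simp: set_pmf_iff)
  finally show ?thesis .
qed

lemma pmf_integrable_bounded:
  fixes f :: "'a \<Rightarrow> real"
  assumes "\<And>x. x \<in> set_pmf p \<Longrightarrow> \<bar>f x\<bar> \<le> C"
  shows "integrable p f"
  using assms by (intro measure_pmf.integrable_const_bound[where B=C]) (auto simp: AE_measure_pmf_iff)

text \<open>Inventories and purchases are confined to boxes of this kind.\<close>

lemma finite_int_box:
  fixes l u :: "'m::finite \<Rightarrow> real"
  shows "finite {q :: 'm \<Rightarrow> int. \<forall>m. l m \<le> of_int (q m) \<and> of_int (q m) \<le> u m}"
proof -
  have "{q. \<forall>m. l m \<le> of_int (q m) \<and> of_int (q m) \<le> u m} \<subseteq> (\<Pi>\<^sub>E m\<in>UNIV. {\<lceil>l m\<rceil>..\<lfloor>u m\<rfloor>})"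
    by (auto simp: PiE_def ceiling_le_iff le_floor_iff)
  then show ?thesis by (rule finite_subset) (intro finite_PiE; simp)
qed

lemma pmf_expectation_finite:
  fixes f :: "'a \<Rightarrow> real"
  assumes "finite A" "set_pmf p \<subseteq> A"
  shows "measure_pmf.expectation p f = (\<Sum>a\<in>A. pmf p a * f a)"
  using assms by (subst integral_measure_pmf[of A]) auto

context plant_model
begin

lemma mean_demand_bounds:
  assumes "p \<in> price_set pl k" "y \<in> demand_states pl"
  shows "0 \<le> mean_demand pl k p y" "mean_demand pl k p y \<le> real (demand_max pl k)"
proof -
  show "0 \<le> mean_demand pl k p y" by (simp add: mean_demand_def)
  have "\<bar>mean_demand pl k p y\<bar> \<le> real (demand_max pl k)"
    unfolding mean_demand_def using demand_bounded[OF assms] by (intro abs_pmf_expectation_le) auto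
  then show "mean_demand pl k p y \<le> real (demand_max pl k)" by simp
qed

lemma price_le_max: "p \<in> price_set pl k \<Longrightarrow> p \<le> price_max pl k"
  unfolding price_max_def
  by (intro cSup_upper bounded_imp_bdd_above compact_imp_bounded price_compact)

lemma finite_purchases: "finite (purchases pl x)"
  by (rule finite_subset[OF _ finite_int_box[of "\<lambda>_. 0" "buy_max pl"]]) (auto simp: purchases_def)

text \<open>Feasibility is downward closed since prices are nonnegative: dropping materials from a purchase never
makes it infeasible or more expensive.\<close>

lemma restricted_purchase:
  assumes x: "x \<in> supply_states pl" and a: "a \<in> purchases pl x"
  shows "(\<lambda>m. if m \<in> S then a m else 0) \<in> purchases pl x"
    and "cost (\<lambda>m. if m \<in> S then a m else 0) x \<le> cost a x"
proof -
  have a0: "0 \<le> a m" "of_int (a m) \<le> min (buy_max pl m) (snd x m)" for m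
    using a by (auto simp: purchases_def)
  show le: "cost (\<lambda>m. if m \<in> S then a m else 0) x \<le> cost a x"
    unfolding cost_def using a0 supply_nonneg[OF x] by (intro sum_mono mult_left_mono) auto
  then show "(\<lambda>m. if m \<in> S then a m else 0) \<in> purchases pl x"
    using a0 a supply_nonneg[OF x] buy_max_nonneg by (auto simp: purchases_def)
qed

lemma cost_bounds:
  assumes "x \<in> supply_states pl" "a \<in> purchases pl x"
  shows "0 \<le> cost a x" "cost a x \<le> cost_max pl"
  using assms(2) supply_nonneg[OF assms(1)]
  by (auto simp: purchases_def cost_def intro!: sum_nonneg mult_nonneg_nonneg)

text \<open>The defining inequality of the threshold, cleared of the denominators.\<close>

lemma theta_ge:
  assumes "0 < beta pl m k"
  shows "V * (price_max pl k - alpha pl k) + (\<Sum>i\<in>UNIV - {m}. real (beta pl i k) * buy_max pl i)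
      + 2 * real (beta pl m k) * real (mu_max pl m) \<le> real (beta pl m k) * theta pl V m"
proof -
  let ?e = "V * (price_max pl k - alpha pl k) / real (beta pl m k)
      + (\<Sum>i\<in>UNIV - {m}. real (beta pl i k) * buy_max pl i / real (beta pl m k)) + 2 * real (mu_max pl m)"
  have "?e \<le> theta pl V m"
    unfolding theta_def using assms by (intro Max_ge) auto
  then have "real (beta pl m k) * ?e \<le> real (beta pl m k) * theta pl V m"
    by (intro mult_left_mono) auto
  moreover have "real (beta pl m k) * ?e = V * (price_max pl k - alpha pl k)
      + (\<Sum>i\<in>UNIV - {m}. real (beta pl i k) * buy_max pl i) + 2 * real (beta pl m k) * real (mu_max pl m)"
    using assms by (simp add: sum_divide_distrib[symmetric] field_simps)
  ultimately show ?thesis by simp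
qed

text \<open>The threshold is a maximum of finitely many affine functions of \<open>V\<close>.\<close>

lemma Q_max_bigo: "(\<lambda>V. Q_max pl V m) \<in> O(\<lambda>V. V)"
proof -
  define S where "S = {k. 0 < beta pl m k}"
  define a where "a k = (price_max pl k - alpha pl k) / real (beta pl m k)" for k
  define b where "b k = (\<Sum>i\<in>UNIV - {m}. real (beta pl i k) * buy_max pl i / real (beta pl m k))
      + 2 * real (mu_max pl m)" for k
  define C where "C = (\<Sum>k\<in>UNIV. \<bar>a k\<bar> + \<bar>b k\<bar>) + buy_max pl m"
  have "\<bar>Q_max pl V m\<bar> \<le> C * V" if V: "1 \<le> V" for V
  proof -
    have th: "theta pl V m = Max ((\<lambda>k. V * a k + b k) ` S)"
      by (simp add: theta_def a_def b_def S_def add.assoc)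
    have "theta pl V m \<in> (\<lambda>k. V * a k + b k) ` S"
      unfolding th using material_used[of m] by (intro Max_in) (auto simp: S_def)
    then obtain k where k: "theta pl V m = V * a k + b k" by blast
    have "\<bar>theta pl V m\<bar> \<le> V * \<bar>a k\<bar> + 1 * \<bar>b k\<bar>"
      unfolding k using V abs_triangle_ineq[of "V * a k" "b k"] by (simp add: abs_mult)
    \<comment> \<open>The constant part is absorbed since \<open>1 \<le> V\<close>.\<close>
    also have "\<dots> \<le> V * \<bar>a k\<bar> + V * \<bar>b k\<bar>" using V by (intro add_left_mono mult_right_mono) auto
    also have "\<dots> = V * (\<bar>a k\<bar> + \<bar>b k\<bar>)" by (simp add: algebra_simps)
    also have "\<dots> \<le> V * (\<Sum>k\<in>UNIV. \<bar>a k\<bar> + \<bar>b k\<bar>)"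
      using V by (intro mult_left_mono member_le_sum[of k UNIV "\<lambda>k. \<bar>a k\<bar> + \<bar>b k\<bar>"]) auto
    finally have 1: "\<bar>theta pl V m\<bar> \<le> V * (\<Sum>k\<in>UNIV. \<bar>a k\<bar> + \<bar>b k\<bar>)" .
    have "1 * buy_max pl m \<le> V * buy_max pl m" using V buy_max_nonneg by (intro mult_right_mono) auto
    with 1 show ?thesis
      using buy_max_nonneg[of m] by (simp add: Q_max_def C_def algebra_simps)
  qed
  then show ?thesis
    by (intro bigoI[where c=C]) (auto simp: eventually_at_top_linorder intro!: exI[of _ 1])
qed

lemma pricing_metric_eq:
  "pricing_metric pl V \<theta> q y k p = mean_demand pl k p y *
     (V * (p - alpha pl k) + (\<Sum>m\<in>UNIV. real (beta pl m k) * (of_int (q m) - \<theta> m)))"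
  by (simp add: pricing_metric_def algebra_simps)

text \<open>A low inventory of \<open>m\<close> enters the metric of a product containing \<open>m\<close> with weight at most
\<open>2 * mu_max pl m - theta pl V m\<close>.  The threshold is chosen so that this outweighs the largest margin,
scaled by \<open>V\<close>, together with the largest excess of all other inventories over their thresholds.\<close>

lemma pricing_metric_nonpos_when_low:
  assumes V: "0 < V" and k: "0 < beta pl m k" and low: "of_int (q m) < 2 * real (mu_max pl m)"
    and q: "\<And>i. of_int (q i) \<le> Q_max pl V i"
    and p: "p \<in> price_set pl k" and y: "y \<in> demand_states pl"
  shows "pricing_metric pl V (theta pl V) q y k p \<le> 0"
proof -
  have "(\<Sum>i\<in>UNIV. real (beta pl i k) * (of_int (q i) - theta pl V i))
      = real (beta pl m k) * (of_int (q m) - theta pl V m)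
        + (\<Sum>i\<in>UNIV - {m}. real (beta pl i k) * (of_int (q i) - theta pl V i))"
    by (simp add: sum.remove[of UNIV m])
  also have "\<dots> \<le> real (beta pl m k) * (of_int (q m) - theta pl V m)
        + (\<Sum>i\<in>UNIV - {m}. real (beta pl i k) * buy_max pl i)"
    using q by (intro add_left_mono sum_mono mult_left_mono) (auto simp: Q_max_def algebra_simps)
  also have "\<dots> \<le> real (beta pl m k) * (of_int (q m) - 2 * real (mu_max pl m)) - V * (price_max pl k - alpha pl k)"
    using theta_ge[OF k, of V] by (simp add: algebra_simps)
  also have "\<dots> \<le> 0 - V * (p - alpha pl k)"
    using low V price_le_max[OF p] by (intro diff_mono mult_left_mono mult_nonneg_nonpos) auto
  finally show ?thesis
    unfolding pricing_metric_eq using mean_demand_bounds[OF p y] by (intro mult_nonneg_nonpos) auto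
qed

end

text \<open>Dropping \<open>m\<close> from the purchase would strictly decrease the metric.\<close>

lemma (in plant_model) min_purchase_zero_above_threshold:
  assumes V: "0 < V" and x: "x \<in> supply_states pl"
    and min: "is_arg_min (purchase_metric V \<theta> q x) (\<lambda>a. a \<in> purchases pl x) a"
    and q: "\<theta> m < of_int (q m)"
  shows "a m = 0"
proof (rule ccontr)
  assume "a m \<noteq> 0"
  have a: "a \<in> purchases pl x" using min by (simp add: is_arg_min_def)
  with \<open>a m \<noteq> 0\<close> have am: "0 < a m"
    unfolding purchases_def by (auto simp: less_le)
  let ?b = "\<lambda>i. if i \<in> UNIV - {m} then a i else 0"
  have "V * cost ?b x \<le> V * cost a x"
    using restricted_purchase(2)[OF x a, of "UNIV - {m}"] V by simp
  moreover have "(\<Sum>i\<in>UNIV. of_int (?b i) * (of_int (q i) - \<theta> i)) < (\<Sum>i\<in>UNIV. of_int (a i) * (of_int (q i) - \<theta> i))"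
    using am q by (intro sum_strict_mono_ex1) auto
  ultimately have "purchase_metric V \<theta> q x ?b < purchase_metric V \<theta> q x a"
    unfolding purchase_metric_def by linarith
  moreover have "?b \<in> purchases pl x" by (rule restricted_purchase(1)[OF x a])
  ultimately show False using min by (auto simp: is_arg_min_def)
qed

section \<open>Inventory bounds along a run\<close>

locale jpp_iid_run = jpp_run pl M R V "theta pl V"
  for pl :: "('m::finite, 'k::finite, 'y) plant" and M :: "'w measure"
    and R :: "('w, 'm, 'k, 'y) trajectory" and V :: real +
  assumes V_pos: "0 < V"
    and initial_range: "\<omega> \<in> space M \<Longrightarrow> real (mu_max pl m) \<le> of_int (inventory R 0 \<omega> m)"
      "\<omega> \<in> space M \<Longrightarrow> of_int (inventory R 0 \<omega> m) \<le> Q_max pl V m"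
    and iid: "iid_states M R"
begin

definition units_used :: "nat \<Rightarrow> 'w \<Rightarrow> 'm \<Rightarrow> int" where
  "units_used t \<omega> m = (\<Sum>k\<in>UNIV. int (beta pl m k) * of_bool (offer (decide R t \<omega>) k) * int (demand R t \<omega> k))"

lemma inventory_Suc:
  "\<omega> \<in> space M \<Longrightarrow> inventory R (Suc t) \<omega> m = inventory R t \<omega> m - units_used t \<omega> m + buy (decide R t \<omega>) m"
  unfolding units_used_def
  by (rule inventory_update) (use initial_range(1) order_trans[OF of_nat_0_le_iff] of_int_0_le_iff in blast)+

lemma units_used_bounds:
  assumes "\<omega> \<in> space M"
  shows "0 \<le> units_used t \<omega> m" "units_used t \<omega> m \<le> int (mu_max pl m)"
proof -
  show "0 \<le> units_used t \<omega> m" by (auto simp: units_used_def intro!: sum_nonneg)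
  show "units_used t \<omega> m \<le> int (mu_max pl m)"
    unfolding units_used_def mu_max_def of_nat_sum of_nat_mult
    using demand_le[OF assms] by (intro sum_mono) (auto intro!: mult_left_mono)
qed

lemma buy_bounds:
  assumes "\<omega> \<in> space M"
  shows "0 \<le> buy (decide R t \<omega>) m" "of_int (buy (decide R t \<omega>) m) \<le> buy_max pl m"
  using buy_feasible[OF assms, of t] by (auto simp: purchases_def)

text \<open>That no product containing \<open>m\<close> is sold at a low inventory of \<open>m\<close> uses the upper bounds on all other
inventories, so the bounds for all materials are proved in one induction.\<close>

lemma inventory_range:
  assumes \<omega>: "\<omega> \<in> space M"
  shows "int (mu_max pl m) \<le> inventory R t \<omega> m \<and> of_int (inventory R t \<omega> m) \<le> Q_max pl V m"
proof (induction t arbitrary: m)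
  case 0
  then show ?case using initial_range[OF \<omega>, of m] by linarith
next
  case (Suc t)
  let ?q = "inventory R t \<omega>" and ?c = "decide R t \<omega>"
  have dec: "jpp_decision pl V (theta pl V) ?q (supplies R t \<omega>) (market R t \<omega>) ?c"
    by (rule jpp[OF \<omega>])
  have lower: "int (mu_max pl m) \<le> ?q m - units_used t \<omega> m"
  proof (cases "?q m < 2 * int (mu_max pl m)")
    case True
    have "\<not> offer ?c k" if k: "0 < beta pl m k" for k
    proof
      assume o: "offer ?c k"
      have "0 < pricing_metric pl V (theta pl V) ?q (market R t \<omega>) k (price ?c k)"
        using dec o unfolding jpp_decision_def by (metis (no_types))
      moreover have "pricing_metric pl V (theta pl V) ?q (market R t \<omega>) k (price ?c k) \<le> 0"
        using Suc.IH True
        by (intro pricing_metric_nonpos_when_low[OF V_pos k] price_feasible market_in \<omega>) auto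
      ultimately show False by simp
    qed
    then have "units_used t \<omega> m = 0"
      unfolding units_used_def by (intro sum.neutral) auto
    with Suc.IH[of m] show ?thesis by simp
  next
    case False
    with units_used_bounds(2)[OF \<omega>, of t m] show ?thesis by linarith
  qed
  have "of_int (?q m + buy ?c m) \<le> Q_max pl V m"
  proof (cases "theta pl V m < of_int (?q m)")
    case True
    have "buy ?c m = 0"
      by (rule min_purchase_zero_above_threshold[where q="?q" and \<theta>="theta pl V", OF V_pos supply_in[OF \<omega>, of t] _ True])
        (use dec in \<open>simp add: jpp_decision_def\<close>)
    with Suc.IH[of m] show ?thesis by simp
  next
    case False
    with buy_bounds(2)[OF \<omega>, of t m] show ?thesis by (simp add: Q_max_def)
  qed
  then have "of_int (inventory R (Suc t) \<omega> m) \<le> Q_max pl V m"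
    unfolding inventory_Suc[OF \<omega>]
    using units_used_bounds(1)[OF \<omega>, of t m] by simp
  with lower buy_bounds(1)[OF \<omega>, of t m] show ?case
    by (simp add: inventory_Suc[OF \<omega>])
qed

lemma real_inventory_range:
  assumes "\<omega> \<in> space M"
  shows "real (mu_max pl m) \<le> of_int (inventory R t \<omega> m) \<and> of_int (inventory R t \<omega> m) \<le> Q_max pl V m"
proof -
  have "of_int (int (mu_max pl m)) \<le> (of_int (inventory R t \<omega> m) :: real)"
    unfolding of_int_le_iff using inventory_range[OF assms] by blast
  with inventory_range[OF assms] show ?thesis by simp
qed

section \<open>The inventories as a Markov chain\<close>

definition decision_rule where
  "decision_rule = (SOME f. \<forall>t. \<forall>\<omega>\<in>space M. decide R t \<omega> = f (inventory R t \<omega>) (supplies R t \<omega>) (market R t \<omega>))"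

lemma decide_by_rule:
  "\<omega> \<in> space M \<Longrightarrow> decide R t \<omega> = decision_rule (inventory R t \<omega>) (supplies R t \<omega>) (market R t \<omega>)"
  using someI_ex[OF fixed_rule] unfolding decision_rule_def by blast

definition noise :: "nat \<Rightarrow> 'w \<Rightarrow> ('m supply_state \<times> 'y) \<times> ('k \<Rightarrow> nat)" where
  "noise t \<omega> = ((supplies R t \<omega>, market R t \<omega>), demand R t \<omega>)"

text \<open>The update without the cut-off at zero.  It agrees with the actual update along every run, since
fulfilled demands never exceed the inventories.\<close>

fun next_inventory :: "('m \<Rightarrow> int) \<Rightarrow> ('m supply_state \<times> 'y) \<times> ('k \<Rightarrow> nat) \<Rightarrow> 'm \<Rightarrow> int" where
  "next_inventory q ((x, y), d) = (\<lambda>m. q m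
     - (\<Sum>k\<in>UNIV. int (beta pl m k) * of_bool (offer (decision_rule q x y) k) * int (d k)) + buy (decision_rule q x y) m)"

definition state_law :: "('m supply_state \<times> 'y) pmf" where
  "state_law = (SOME \<rho>. measure_pmf \<rho> = distr M (count_space UNIV) (\<lambda>\<omega>. (supplies R 0 \<omega>, market R 0 \<omega>)) \<and>
      (\<forall>a. pmf \<rho> a = prob {\<omega> \<in> space M. (supplies R 0 \<omega>, market R 0 \<omega>) = a}))"

definition demand_kernel :: "('m \<Rightarrow> int) \<Rightarrow> ('m supply_state \<times> 'y) \<Rightarrow> ('k \<Rightarrow> nat) pmf" where
  "demand_kernel q s = joint_demand_law pl (price (decision_rule q (fst s) (snd s))) (snd s)"

definition kernel :: "('m \<Rightarrow> int) \<Rightarrow> (('m supply_state \<times> 'y) \<times> ('k \<Rightarrow> nat)) pmf" where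
  "kernel q = bind_pmf state_law (\<lambda>s. map_pmf (Pair s) (demand_kernel q s))"

lemma states_rv: "discrete_rv M (\<lambda>\<omega>. (supplies R t \<omega>, market R t \<omega>))"
proof (rule discrete_rv_Pair)
  show "discrete_rv M (supplies R t)"
    using supply_measurable[of t] countable_subset[OF _ countable_supply, of "supplies R t ` space M"] supply_in
    by (auto simp: discrete_rv_def)
  show "discrete_rv M (market R t)"
    using market_measurable[of t] countable_subset[OF _ countable_demand, of "market R t ` space M"] market_in
    by (auto simp: discrete_rv_def)
qed

lemma noise_discrete: "discrete_rv M (noise t)"
proof -
  have "discrete_rv M (demand R t)"
    using demand_measurable[of t] by (simp add: discrete_rv_def countableI_type)
  from discrete_rv_Pair[OF states_rv this] show ?thesis by (simp add: noise_def[abs_def])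
qed

lemma inventory_next: "\<omega> \<in> space M \<Longrightarrow> inventory R (Suc t) \<omega> = next_inventory (inventory R t \<omega>) (noise t \<omega>)"
  by (auto simp: inventory_Suc units_used_def decide_by_rule noise_def)

lemma inventory_rv: "discrete_rv M (inventory R t)"
proof (induction t)
  case 0
  then show ?case
    using inventory_measurable by (simp add: discrete_rv_def countableI_type)
next
  case (Suc t)
  from discrete_rv_compose[OF discrete_rv_Pair[OF this noise_discrete[of t]], of "\<lambda>(q, w). next_inventory q w"]
  show ?case
    by (subst discrete_rv_cong[where Y="\<lambda>\<omega>. next_inventory (inventory R t \<omega>) (noise t \<omega>)"])
      (auto simp: inventory_next simp del: next_inventory.simps)
qed

lemma past_rv: "discrete_rv M (past R t)"
proof -
  have "discrete_rv M (\<lambda>\<omega>. (supplies R s \<omega>, market R s \<omega>, decide R s \<omega>, demand R s \<omega>))" for s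
  proof -
    from discrete_rv_compose[OF discrete_rv_Pair[OF inventory_rv[of s] noise_discrete[of s]],
        of "\<lambda>(q, ((x, y), d)). (x, y, decision_rule q x y, d)"]
    show ?thesis
      by (subst discrete_rv_cong[where Y="\<lambda>\<omega>. (supplies R s \<omega>, market R s \<omega>,
          decision_rule (inventory R s \<omega>) (supplies R s \<omega>) (market R s \<omega>), demand R s \<omega>)"])
        (auto simp: noise_def decide_by_rule)
  qed
  then show ?thesis
    unfolding past_def[abs_def]
    by (intro discrete_rv_Pair[OF discrete_rv_map discrete_rv_map] inventory_rv)
qed

lemma state_law:
  "measure_pmf state_law = distr M (count_space UNIV) (\<lambda>\<omega>. (supplies R 0 \<omega>, market R 0 \<omega>))"
  "pmf state_law s = prob {\<omega> \<in> space M. (supplies R 0 \<omega>, market R 0 \<omega>) = s}"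
  using someI_ex[OF discrete_rv_law[OF states_rv[of 0]], folded state_law_def] by blast+

text \<open>The states of all slots have the law of the initial ones.\<close>

lemma pmf_state_law: "pmf state_law s = prob {\<omega> \<in> space M. (supplies R t \<omega>, market R t \<omega>) = s}"
proof -
  have m: "measure (distr M (count_space UNIV) (\<lambda>\<omega>. (supplies R t \<omega>, market R t \<omega>))) {s}
      = prob {\<omega> \<in> space M. (supplies R t \<omega>, market R t \<omega>) = s}" for t
    by (subst measure_distr) (auto intro: discrete_rv_measurable[OF states_rv] arg_cong[where f=prob])
  have "distr M (count_space UNIV) (\<lambda>\<omega>. (supplies R t \<omega>, market R t \<omega>))
      = distr M (count_space UNIV) (\<lambda>\<omega>. (supplies R 0 \<omega>, market R 0 \<omega>))"
    using iid unfolding iid_states_def by blast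
  then show ?thesis
    unfolding state_law(2) m[symmetric] by simp
qed

lemma state_law_image:
  fixes f :: "_ \<Rightarrow> 'b"
  shows "pmf (map_pmf f state_law) b = prob {\<omega> \<in> space M. f (supplies R 0 \<omega>, market R 0 \<omega>) = b}"
  unfolding pmf_map state_law(1)
  by (subst measure_distr) (auto intro: discrete_rv_measurable[OF states_rv] arg_cong[where f=prob])

lemma state_law_marginals:
  "map_pmf fst state_law = supply_pmf pl" "map_pmf snd state_law = demand_state_pmf pl"
  by (auto intro!: pmf_eqI simp: state_law_image supply_law market_law)

lemma last_past: "last (fst (past R t \<omega>)) = inventory R t \<omega>"
  by (simp add: past_def)

text \<open>The states are independent of the past and the demands have the prescribed conditional law; the
decision adds no randomness, as it is determined by the past and the states.\<close>

lemma noise_law_kernel: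
  "prob {\<omega> \<in> space M. past R t \<omega> = h \<and> noise t \<omega> = w} = prob {\<omega> \<in> space M. past R t \<omega> = h} * pmf (kernel (last (fst h))) w"
proof -
  obtain x y d where w: "w = ((x, y), d)" by (metis surj_pair)
  define c where "c = decision_rule (last (fst h)) x y"
  have dec: "decide R t \<omega> = c" if "\<omega> \<in> space M" "past R t \<omega> = h" "supplies R t \<omega> = x" "market R t \<omega> = y" for \<omega>
    using decide_by_rule[OF that(1), of t] that(2-) last_past[of t \<omega>] by (simp add: c_def)
  have "prob {\<omega> \<in> space M. past R t \<omega> = h \<and> noise t \<omega> = w}
      = prob {\<omega>\<in>space M. past R t \<omega> = h \<and> supplies R t \<omega> = x \<and> market R t \<omega> = y \<and> decide R t \<omega> = c \<and> demand R t \<omega> = d}"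
    using dec by (intro arg_cong[where f=prob]) (auto simp: w noise_def)
  also have "\<dots> = prob {\<omega>\<in>space M. past R t \<omega> = h \<and> supplies R t \<omega> = x \<and> market R t \<omega> = y \<and> decide R t \<omega> = c}
      * pmf (joint_demand_law pl (price c) y) d"
    by (rule demand_conditional)
  also have "{\<omega>\<in>space M. past R t \<omega> = h \<and> supplies R t \<omega> = x \<and> market R t \<omega> = y \<and> decide R t \<omega> = c}
      = (past R t -` {h} \<inter> space M) \<inter> ((\<lambda>\<omega>. (supplies R t \<omega>, market R t \<omega>)) -` {(x, y)} \<inter> space M)"
    using dec by auto
  also have "prob \<dots> = prob (past R t -` {h} \<inter> space M) * prob ((\<lambda>\<omega>. (supplies R t \<omega>, market R t \<omega>)) -` {(x, y)} \<inter> space M)"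
    using iid unfolding iid_states_def
    by (intro indep_setD) (auto simp: sets_vimage_algebra)
  also have "past R t -` {h} \<inter> space M = {\<omega> \<in> space M. past R t \<omega> = h}" by auto
  also have "(\<lambda>\<omega>. (supplies R t \<omega>, market R t \<omega>)) -` {(x, y)} \<inter> space M = {\<omega> \<in> space M. (supplies R t \<omega>, market R t \<omega>) = (x, y)}" by auto
  finally show ?thesis
    unfolding kernel_def w pmf_bind_Pair
    by (simp only: pmf_state_law[of "(x, y)" t] demand_kernel_def c_def fst_conv snd_conv mult.assoc)
qed

sublocale chain: controlled_chain M "past R" noise "inventory R" "\<lambda>h. last (fst h)" next_inventory kernel
proof
  show "discrete_rv M (past R t)" for t by (rule past_rv)
  show "discrete_rv M (noise t)" for t by (rule noise_discrete)
  show "inventory R t \<omega> = last (fst (past R t \<omega>))" for t \<omega> by (simp add: last_past)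
  show "prob {\<omega> \<in> space M. past R t \<omega> = h \<and> noise t \<omega> = w} = prob {\<omega> \<in> space M. past R t \<omega> = h} * pmf (kernel (last (fst h))) w" for t h w
    by (rule noise_law_kernel)
  show "inventory R (Suc t) \<omega> = next_inventory (inventory R t \<omega>) (noise t \<omega>)" if "\<omega> \<in> space M" for t \<omega>
    using that by (rule inventory_next)
  show "\<exists>u. \<forall>\<omega>\<in>space M. (inventory R s \<omega>, noise s \<omega>) = u (past R t \<omega>)" if "s < t" for s t
    using that
    by (intro exI[of _ "\<lambda>(qs, vs). (qs ! s, case vs ! s of (x, y, c, d) \<Rightarrow> ((x, y), d))"])
      (auto simp: past_def noise_def nth_append simp del: upt_Suc)
qed

end

section \<open>Stationary randomised policies\<close>

context plant_model
begin

text \<open>The inner averages of \<open>c_hat\<close>, \<open>a_hat\<close>, \<open>r_hat\<close> and \<open>mu_hat\<close>, for a fixed supply or demand state.\<close>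

definition spending where
  "spending \<gamma> x = (\<Sum>a\<in>purchases pl x. pmf (\<gamma> x) a * cost a x)"

definition purchased where
  "purchased \<gamma> m x = (\<Sum>a\<in>purchases pl x. pmf (\<gamma> x) a * of_int (a m))"

definition revenue where
  "revenue \<nu> y = (\<Sum>k\<in>UNIV. \<integral>(z, p). of_bool (z k) * (p k - alpha pl k) * mean_demand pl k (p k) y \<partial>\<nu> y)"

definition consumed where
  "consumed \<nu> m y = (\<Sum>k\<in>UNIV. real (beta pl m k) * (\<integral>(z, p). of_bool (z k) * mean_demand pl k (p k) y \<partial>\<nu> y))"

lemma purchase_policy_average:
  assumes "purchase_policy pl \<gamma>" "x \<in> supply_states pl"
  shows "spending \<gamma> x = measure_pmf.expectation (\<gamma> x) (\<lambda>a. cost a x)"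
    and "purchased \<gamma> m x = measure_pmf.expectation (\<gamma> x) (\<lambda>a. of_int (a m))"
  using assms unfolding spending_def purchased_def purchase_policy_def
  by (subst pmf_expectation_finite[OF finite_purchases[of x]]; auto)+

lemma purchase_policy_bounds:
  assumes \<gamma>: "purchase_policy pl \<gamma>" and x: "x \<in> supply_states pl"
  shows "\<bar>spending \<gamma> x\<bar> \<le> cost_max pl" "\<bar>purchased \<gamma> m x\<bar> \<le> buy_max pl m"
proof -
  have a: "a \<in> purchases pl x" if "a \<in> set_pmf (\<gamma> x)" for a
    using \<gamma> x that by (auto simp: purchase_policy_def)
  show "\<bar>spending \<gamma> x\<bar> \<le> cost_max pl"
    unfolding purchase_policy_average[OF \<gamma> x]
    using cost_bounds[OF x a] by (intro abs_pmf_expectation_le) auto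
  show "\<bar>purchased \<gamma> m x\<bar> \<le> buy_max pl m"
    unfolding purchase_policy_average[OF \<gamma> x]
    using a by (intro abs_pmf_expectation_le) (auto simp: purchases_def)
qed

text \<open>The minimiser is compared with a purchase drawn from the policy from which all materials with
\<open>\<theta> m < q m\<close> have been dropped.  This replaces the weights \<open>q m - \<theta> m\<close> by their negative parts.\<close>

lemma min_purchase_le_policy:
  assumes V: "0 < V" and \<gamma>: "purchase_policy pl \<gamma>" and x: "x \<in> supply_states pl"
    and min: "is_arg_min (purchase_metric V \<theta> q x) (\<lambda>a. a \<in> purchases pl x) b"
  shows "purchase_metric V \<theta> q x b
    \<le> V * spending \<gamma> x + (\<Sum>m\<in>UNIV. min 0 (of_int (q m) - \<theta> m) * purchased \<gamma> m x)"
proof -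
  define g where "g a = V * cost a x + (\<Sum>m\<in>UNIV. min 0 (of_int (q m) - \<theta> m) * of_int (a m))" for a
  have fin: "finite (set_pmf (\<gamma> x))"
    using \<gamma> x finite_purchases[of x] by (auto simp: purchase_policy_def intro: finite_subset)
  have "purchase_metric V \<theta> q x b \<le> g a" if "a \<in> set_pmf (\<gamma> x)" for a
  proof -
    have a: "a \<in> purchases pl x" using \<gamma> x that by (auto simp: purchase_policy_def)
    let ?S = "{m. of_int (q m) \<le> \<theta> m}"
    let ?a = "\<lambda>m. if m \<in> ?S then a m else 0"
    have "purchase_metric V \<theta> q x b \<le> purchase_metric V \<theta> q x ?a"
      using min restricted_purchase(1)[OF x a, of ?S] by (force simp: is_arg_min_def not_less)
    also have "\<dots> \<le> V * cost a x + (\<Sum>m\<in>UNIV. min 0 (of_int (q m) - \<theta> m) * of_int (a m))"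
      unfolding purchase_metric_def
      using V restricted_purchase(2)[OF x a, of ?S]
      by (intro add_mono mult_left_mono sum_mono) auto
    finally show ?thesis by (simp add: g_def)
  qed
  then have "measure_pmf.expectation (\<gamma> x) (\<lambda>_. purchase_metric V \<theta> q x b) \<le> measure_pmf.expectation (\<gamma> x) g"
    by (intro integral_mono_AE integrable_measure_pmf_finite fin) (auto simp: AE_measure_pmf_iff)
  also have "\<dots> = V * spending \<gamma> x + (\<Sum>m\<in>UNIV. min 0 (of_int (q m) - \<theta> m) * purchased \<gamma> m x)"
    unfolding purchase_policy_average[OF \<gamma> x] g_def
    using integrable_measure_pmf_finite[OF fin, where 'b=real] by simp
  finally show ?thesis by simp
qed

text \<open>Mean demand is continuous on the price sets only, which is why the prices of an offer carry the
restricted Borel structure.\<close>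

lemma offer_measurable:
  assumes "sets N = sets (offer_space pl)" and y: "y \<in> demand_states pl"
  shows "(\<lambda>(z, p). of_bool (z k) * mean_demand pl k (p k) y) \<in> borel_measurable N"
    and "(\<lambda>(z, p). of_bool (z k) * (p k - alpha pl k) * mean_demand pl k (p k) y) \<in> borel_measurable N"
proof -
  have p: "(\<lambda>x. snd x k) \<in> offer_space pl \<rightarrow>\<^sub>M restrict_space borel (price_set pl k)"
    unfolding offer_space_def
    by (rule measurable_compose[OF measurable_snd measurable_component_singleton]) simp
  have z: "(\<lambda>x. of_bool (fst x k) :: real) \<in> borel_measurable (offer_space pl)"
    unfolding offer_space_def
    by (rule measurable_compose[OF measurable_compose[OF measurable_fst measurable_component_singleton]]) auto
  have F: "(\<lambda>x. mean_demand pl k (snd x k) y) \<in> borel_measurable (offer_space pl)"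
    by (rule measurable_compose[OF p borel_measurable_continuous_on_restrict])
      (rule mean_demand_continuous[OF y])
  have P: "(\<lambda>x. snd x k) \<in> borel_measurable (offer_space pl)"
    by (rule measurable_compose[OF p, of "\<lambda>x. x"]) (simp add: measurable_restrict_space1)
  note [measurable] = z F P
  note cong = measurable_cong_sets[OF assms(1) refl]
  show "(\<lambda>(z, p). of_bool (z k) * mean_demand pl k (p k) y) \<in> borel_measurable N"
    unfolding cong case_prod_beta by measurable
  show "(\<lambda>(z, p). of_bool (z k) * (p k - alpha pl k) * mean_demand pl k (p k) y) \<in> borel_measurable N"
    unfolding cong case_prod_beta by measurable
qed

lemma offer_price_in:
  assumes "pricing_policy pl \<nu>" "y \<in> demand_states pl" "(z, p) \<in> space (\<nu> y)"
  shows "p k \<in> price_set pl k"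
proof -
  have "space (\<nu> y) = space (offer_space pl)"
    using assms(1,2) by (intro sets_eq_imp_space_eq) (simp add: pricing_policy_def)
  with assms(3) show ?thesis
    by (auto simp: offer_space_def space_pair_measure space_PiM space_restrict_space)
qed

lemma margin_bound:
  assumes "p \<in> price_set pl k"
  shows "\<bar>p - alpha pl k\<bar> \<le> price_max pl k + alpha pl k"
  using price_le_max[OF assms] price_nonneg[OF assms] alpha_nonneg[of k] by linarith

lemma offer_integrals:
  assumes \<nu>: "pricing_policy pl \<nu>" and y: "y \<in> demand_states pl"
  shows "integrable (\<nu> y) (\<lambda>(z, p). of_bool (z k) * mean_demand pl k (p k) y)"
    and "integrable (\<nu> y) (\<lambda>(z, p). of_bool (z k) * (p k - alpha pl k) * mean_demand pl k (p k) y)"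
    and "0 \<le> (\<integral>(z, p). of_bool (z k) * mean_demand pl k (p k) y \<partial>\<nu> y)"
    and "\<bar>\<integral>(z, p). of_bool (z k) * mean_demand pl k (p k) y \<partial>\<nu> y\<bar> \<le> real (demand_max pl k)"
    and "\<bar>\<integral>(z, p). of_bool (z k) * (p k - alpha pl k) * mean_demand pl k (p k) y \<partial>\<nu> y\<bar>
      \<le> (price_max pl k + alpha pl k) * real (demand_max pl k)"
proof -
  interpret N: prob_space "\<nu> y" using \<nu> y by (simp add: pricing_policy_def)
  have sets: "sets (\<nu> y) = sets (offer_space pl)" using \<nu> y by (simp add: pricing_policy_def)
  have le: "\<bar>integral\<^sup>L (\<nu> y) f\<bar> \<le> C"
    if "integrable (\<nu> y) f" "\<And>x. x \<in> space (\<nu> y) \<Longrightarrow> \<bar>f x\<bar> \<le> C" for f and C :: real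
  proof -
    have "\<bar>integral\<^sup>L (\<nu> y) f\<bar> \<le> (\<integral>x. \<bar>f x\<bar> \<partial>\<nu> y)" by (rule integral_abs_bound)
    also have "\<dots> \<le> (\<integral>x. C \<partial>\<nu> y)" using that by (intro integral_mono) auto
    finally show ?thesis by (simp add: N.prob_space)
  qed
  have b1: "\<bar>case x of (z, p) \<Rightarrow> of_bool (z k) * mean_demand pl k (p k) y\<bar> \<le> real (demand_max pl k)"
    if "x \<in> space (\<nu> y)" for x
  proof (cases x)
    case (Pair z p)
    with mean_demand_bounds[OF offer_price_in[OF \<nu> y, of z p] y, of k] that show ?thesis by auto
  qed
  have b2: "\<bar>case x of (z, p) \<Rightarrow> of_bool (z k) * (p k - alpha pl k) * mean_demand pl k (p k) y\<bar>
      \<le> (price_max pl k + alpha pl k) * real (demand_max pl k)" if "x \<in> space (\<nu> y)" for x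
  proof (cases x)
    case (Pair z p)
    then have p: "p k \<in> price_set pl k" using offer_price_in[OF \<nu> y] that by blast
    have "\<bar>p k - alpha pl k\<bar> * \<bar>mean_demand pl k (p k) y\<bar> \<le> (price_max pl k + alpha pl k) * real (demand_max pl k)"
      using margin_bound[OF p] mean_demand_bounds[OF p y] by (intro mult_mono) auto
    moreover have "0 \<le> (price_max pl k + alpha pl k) * real (demand_max pl k)"
      using order_trans[OF abs_ge_zero margin_bound[OF p]] by simp
    ultimately show ?thesis by (simp add: Pair abs_mult)
  qed
  show i1: "integrable (\<nu> y) (\<lambda>(z, p). of_bool (z k) * mean_demand pl k (p k) y)"
    using b1 by (intro N.integrable_const_bound[OF AE_I2 offer_measurable(1)[OF sets y]]) auto
  show i2: "integrable (\<nu> y) (\<lambda>(z, p). of_bool (z k) * (p k - alpha pl k) * mean_demand pl k (p k) y)"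
    using b2 by (intro N.integrable_const_bound[OF AE_I2 offer_measurable(2)[OF sets y]]) auto
  show "0 \<le> (\<integral>(z, p). of_bool (z k) * mean_demand pl k (p k) y \<partial>\<nu> y)"
    using mean_demand_bounds(1)[OF offer_price_in[OF \<nu> y] y]
    by (intro Bochner_Integration.integral_nonneg) auto
  show "\<bar>\<integral>(z, p). of_bool (z k) * mean_demand pl k (p k) y \<partial>\<nu> y\<bar> \<le> real (demand_max pl k)"
    by (rule le[OF i1 b1])
  show "\<bar>\<integral>(z, p). of_bool (z k) * (p k - alpha pl k) * mean_demand pl k (p k) y \<partial>\<nu> y\<bar>
      \<le> (price_max pl k + alpha pl k) * real (demand_max pl k)"
    by (rule le[OF i2 b2])
qed

lemma pricing_policy_bounds:
  assumes \<nu>: "pricing_policy pl \<nu>" and y: "y \<in> demand_states pl"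
  shows "\<bar>revenue \<nu> y\<bar> \<le> (\<Sum>k\<in>UNIV. (price_max pl k + alpha pl k) * real (demand_max pl k))"
    and "0 \<le> consumed \<nu> m y" "\<bar>consumed \<nu> m y\<bar> \<le> real (mu_max pl m)"
proof -
  show "\<bar>revenue \<nu> y\<bar> \<le> (\<Sum>k\<in>UNIV. (price_max pl k + alpha pl k) * real (demand_max pl k))"
    unfolding revenue_def using offer_integrals(5)[OF \<nu> y] by (intro sum_abs[THEN order_trans] sum_mono)
  show 0: "0 \<le> consumed \<nu> m y"
    unfolding consumed_def using offer_integrals(3)[OF \<nu> y] by (intro sum_nonneg mult_nonneg_nonneg) auto
  have "consumed \<nu> m y \<le> (\<Sum>k\<in>UNIV. real (beta pl m k) * real (demand_max pl k))"
    unfolding consumed_def using offer_integrals(4)[OF \<nu> y] by (intro sum_mono mult_left_mono) (auto simp: abs_le_iff)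
  with 0 show "\<bar>consumed \<nu> m y\<bar> \<le> real (mu_max pl m)" by (simp add: mu_max_def)
qed

text \<open>The number \<open>v k\<close> stands for the best value obtainable from product \<open>k\<close>, including the option not to
offer it.  The collected metrics of the policy split into revenue and weighted consumption.\<close>

lemma policy_le_best_prices:
  assumes \<nu>: "pricing_policy pl \<nu>" and y: "y \<in> demand_states pl"
    and v: "\<And>k. 0 \<le> v k" "\<And>k p. p \<in> price_set pl k \<Longrightarrow> pricing_metric pl V \<theta> q y k p \<le> v k"
  shows "V * revenue \<nu> y + (\<Sum>m\<in>UNIV. (of_int (q m) - \<theta> m) * consumed \<nu> m y) \<le> (\<Sum>k\<in>UNIV. v k)"
proof -
  interpret N: prob_space "\<nu> y" using \<nu> y by (simp add: pricing_policy_def)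
  let ?r = "\<lambda>k. \<integral>(z, p). of_bool (z k) * (p k - alpha pl k) * mean_demand pl k (p k) y \<partial>\<nu> y"
  let ?c = "\<lambda>k. \<integral>(z, p). of_bool (z k) * mean_demand pl k (p k) y \<partial>\<nu> y"
  let ?w = "\<lambda>k. \<Sum>m\<in>UNIV. real (beta pl m k) * (of_int (q m) - \<theta> m)"
  have "V * ?r k + ?w k * ?c k \<le> v k" for k
  proof -
    note i = offer_integrals(1,2)[OF \<nu> y, of k]
    have "V * ?r k + ?w k * ?c k = (\<integral>x. V * (case x of (z, p) \<Rightarrow> of_bool (z k) * (p k - alpha pl k) * mean_demand pl k (p k) y)
        + ?w k * (case x of (z, p) \<Rightarrow> of_bool (z k) * mean_demand pl k (p k) y) \<partial>\<nu> y)"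
      using i by simp
    also have "\<dots> \<le> (\<integral>x. v k \<partial>\<nu> y)"
    proof (rule integral_mono)
      fix x assume x: "x \<in> space (\<nu> y)"
      obtain z p where zp: "x = (z, p)" by fastforce
      have "of_bool (z k) * pricing_metric pl V \<theta> q y k (p k) \<le> v k"
        using v offer_price_in[OF \<nu> y, of z p k] x zp by auto
      then show "V * (case x of (z, p) \<Rightarrow> of_bool (z k) * (p k - alpha pl k) * mean_demand pl k (p k) y)
        + ?w k * (case x of (z, p) \<Rightarrow> of_bool (z k) * mean_demand pl k (p k) y) \<le> v k"
        by (simp add: zp pricing_metric_def algebra_simps)
    qed (use i in auto)
    finally show ?thesis by (simp add: N.prob_space)
  qed
  then have "(\<Sum>k\<in>UNIV. V * ?r k + ?w k * ?c k) \<le> (\<Sum>k\<in>UNIV. v k)" by (intro sum_mono)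
  moreover have "(\<Sum>k\<in>UNIV. V * ?r k + ?w k * ?c k) = V * revenue \<nu> y + (\<Sum>m\<in>UNIV. (of_int (q m) - \<theta> m) * consumed \<nu> m y)"
  proof -
    have "(\<Sum>k\<in>UNIV. ?w k * ?c k) = (\<Sum>k\<in>UNIV. \<Sum>m\<in>UNIV. (of_int (q m) - \<theta> m) * (real (beta pl m k) * ?c k))"
      by (simp add: sum_distrib_right mult_ac)
    also have "\<dots> = (\<Sum>m\<in>UNIV. (of_int (q m) - \<theta> m) * consumed \<nu> m y)"
      by (subst sum.swap) (simp add: consumed_def sum_distrib_left)
    finally show ?thesis by (simp add: sum.distrib revenue_def sum_distrib_left)
  qed
  ultimately show ?thesis by simp
qed

lemma hat_expectations:
  assumes \<gamma>: "purchase_policy pl \<gamma>" and \<nu>: "pricing_policy pl \<nu>"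
  shows "measure_pmf.expectation (supply_pmf pl) (spending \<gamma>) = c_hat pl \<gamma>"
    and "measure_pmf.expectation (supply_pmf pl) (purchased \<gamma> m) = a_hat pl \<gamma> m"
    and "measure_pmf.expectation (demand_state_pmf pl) (revenue \<nu>) = r_hat pl \<nu>"
    and "measure_pmf.expectation (demand_state_pmf pl) (consumed \<nu> m) = mu_hat pl \<nu> m"
proof -
  have s: "x \<in> supply_states pl" if "x \<in> set_pmf (supply_pmf pl)" for x
    using that supply_pmf by blast
  have d: "y \<in> demand_states pl" if "y \<in> set_pmf (demand_state_pmf pl)" for y
    using that demand_state_pmf by blast
  show "measure_pmf.expectation (supply_pmf pl) (spending \<gamma>) = c_hat pl \<gamma>"
    unfolding c_hat_def spending_def[symmetric]
    by (rule pmf_expectation_eq_infsum[OF purchase_policy_bounds(1)[OF \<gamma> s] supply_pmf])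
  show "measure_pmf.expectation (supply_pmf pl) (purchased \<gamma> m) = a_hat pl \<gamma> m"
    unfolding a_hat_def purchased_def[symmetric]
    by (rule pmf_expectation_eq_infsum[OF purchase_policy_bounds(2)[OF \<gamma> s] supply_pmf])
  show "measure_pmf.expectation (demand_state_pmf pl) (revenue \<nu>) = r_hat pl \<nu>"
    unfolding r_hat_def revenue_def[symmetric]
    by (rule pmf_expectation_eq_infsum[OF pricing_policy_bounds(1)[OF \<nu> d] demand_state_pmf])
  show "measure_pmf.expectation (demand_state_pmf pl) (consumed \<nu> m) = mu_hat pl \<nu> m"
    unfolding mu_hat_def consumed_def[symmetric]
    by (rule pmf_expectation_eq_infsum[OF pricing_policy_bounds(3)[OF \<nu> d] demand_state_pmf])
qed

end

section \<open>Lyapunov drift\<close>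

context jpp_iid_run
begin

fun profit :: "('m \<Rightarrow> int) \<Rightarrow> ('m supply_state \<times> 'y) \<times> ('k \<Rightarrow> nat) \<Rightarrow> real" where
  "profit q ((x, y), d) = - cost (buy (decision_rule q x y)) x
     + (\<Sum>k\<in>UNIV. of_bool (offer (decision_rule q x y) k) * real (d k) * (price (decision_rule q x y) k - alpha pl k))"

lemma phi_actual_profit:
  assumes "\<omega> \<in> space M"
  shows "phi_actual pl R t \<omega> = profit (inventory R t \<omega>) (noise t \<omega>)"
  unfolding phi_actual_def noise_def profit.simps decide_by_rule[OF assms, symmetric]
  by (intro arg_cong2[where f="(+)"] refl sum.cong) (simp add: fulfil_all[OF assms])

definition lyap :: "('m \<Rightarrow> int) \<Rightarrow> real" where
  "lyap = lyapunov (theta pl V)"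

text \<open>The profit of a slot corrected by the change of the Lyapunov function, scaled by \<open>V\<close>.  The correction
telescopes over time and is bounded, so it affects no limit of averages; and the corrected profit has
conditional mean at least \<open>phi_opt pl - B_const pl / V\<close> at every reachable inventory vector.\<close>

definition drift_profit :: "('m \<Rightarrow> int) \<Rightarrow> ('m supply_state \<times> 'y) \<times> ('k \<Rightarrow> nat) \<Rightarrow> real" where
  "drift_profit q w = profit q w - (lyap (next_inventory q w) - lyap q) / V"

lemma drift_profit_run:
  "\<omega> \<in> space M \<Longrightarrow> drift_profit (inventory R t \<omega>) (noise t \<omega>)
    = phi_actual pl R t \<omega> - (lyap (inventory R (Suc t) \<omega>) - lyap (inventory R t \<omega>)) / V"
  by (simp add: drift_profit_def phi_actual_profit inventory_next)

lemma phi_actual_bounded: "\<exists>C. \<forall>t. \<forall>\<omega>\<in>space M. \<bar>phi_actual pl R t \<omega>\<bar> \<le> C"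
proof (intro exI allI ballI)
  fix t \<omega> assume \<omega>: "\<omega> \<in> space M"
  have c: "\<bar>cost (buy (decide R t \<omega>)) (supplies R t \<omega>)\<bar> \<le> cost_max pl"
    using cost_bounds[OF supply_in[OF \<omega>] buy_feasible[OF \<omega>]] by simp
  have "\<bar>of_bool (offer (decide R t \<omega>) k) * real (sold R t \<omega> k) * (price (decide R t \<omega>) k - alpha pl k)\<bar>
      \<le> real (demand_max pl k) * (price_max pl k + alpha pl k)" for k
  proof -
    have "\<bar>of_bool (offer (decide R t \<omega>) k) * real (sold R t \<omega> k)\<bar> \<le> real (demand_max pl k)"
      using demand_le[OF \<omega>, of t k] by (simp add: fulfil_all[OF \<omega>])
    then show ?thesis
      unfolding abs_mult[of _ "price (decide R t \<omega>) k - alpha pl k"]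
      using margin_bound[OF price_feasible[OF \<omega>]] by (intro mult_mono) auto
  qed
  then have "\<bar>\<Sum>k\<in>UNIV. of_bool (offer (decide R t \<omega>) k) * real (sold R t \<omega> k) * (price (decide R t \<omega>) k - alpha pl k)\<bar>
      \<le> (\<Sum>k\<in>UNIV. real (demand_max pl k) * (price_max pl k + alpha pl k))"
    by (intro sum_abs[THEN order_trans] sum_mono)
  with c show "\<bar>phi_actual pl R t \<omega>\<bar> \<le> cost_max pl + (\<Sum>k\<in>UNIV. real (demand_max pl k) * (price_max pl k + alpha pl k))"
    unfolding phi_actual_def by linarith
qed

lemma finite_inventories: "finite {q. \<exists>t. \<exists>\<omega>\<in>space M. q = inventory R t \<omega>}"
  using real_inventory_range
  by (intro finite_subset[OF _ finite_int_box[of "\<lambda>m. real (mu_max pl m)" "Q_max pl V"]]) blast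

lemma lyap_bounded: "\<exists>C. \<forall>t. \<forall>\<omega>\<in>space M. \<bar>lyap (inventory R t \<omega>)\<bar> \<le> C"
proof -
  let ?A = "(\<lambda>q. \<bar>lyap q\<bar>) ` {q. \<exists>t. \<exists>\<omega>\<in>space M. q = inventory R t \<omega>}"
  have "finite ?A" using finite_inventories by simp
  then show ?thesis by (intro exI[of _ "Max ?A"]) (auto intro!: Max_ge)
qed

lemma drift_profit_bounded:
  "\<exists>C. \<forall>t. \<forall>\<omega>\<in>space M. \<bar>drift_profit (inventory R t \<omega>) (noise t \<omega>)\<bar> \<le> C"
proof -
  obtain C1 where C1: "\<And>t \<omega>. \<omega> \<in> space M \<Longrightarrow> \<bar>phi_actual pl R t \<omega>\<bar> \<le> C1" using phi_actual_bounded by blast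
  obtain C2 where C2: "\<And>t \<omega>. \<omega> \<in> space M \<Longrightarrow> \<bar>lyap (inventory R t \<omega>)\<bar> \<le> C2" using lyap_bounded by blast
  have "\<bar>drift_profit (inventory R t \<omega>) (noise t \<omega>)\<bar> \<le> C1 + 2 * C2 / V" if \<omega>: "\<omega> \<in> space M" for t \<omega>
  proof -
    have "\<bar>lyap (inventory R (Suc t) \<omega>) - lyap (inventory R t \<omega>)\<bar> \<le> 2 * C2"
      using C2[OF \<omega>, of t] C2[OF \<omega>, of "Suc t"] by linarith
    then have "\<bar>(lyap (inventory R (Suc t) \<omega>) - lyap (inventory R t \<omega>)) / V\<bar> \<le> 2 * C2 / V"
      using V_pos by (simp add: divide_right_mono)
    then show ?thesis unfolding drift_profit_run[OF \<omega>] using C1[OF \<omega>, of t] by linarith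
  qed
  then show ?thesis by blast
qed

text \<open>The pricing metric per unit of demand.\<close>

definition sale_value :: "('m \<Rightarrow> int) \<Rightarrow> 'k \<Rightarrow> real \<Rightarrow> real" where
  "sale_value q k p = V * (p - alpha pl k) + (\<Sum>m\<in>UNIV. real (beta pl m k) * (of_int (q m) - theta pl V m))"

text \<open>Expanding the Lyapunov function: the linear terms are the two metrics that the algorithm optimises,
the quadratic ones are bounded by the constant.\<close>

lemma drift_bound:
  fixes t :: nat
  assumes \<omega>: "\<omega> \<in> space M"
  defines "q \<equiv> inventory R t \<omega>" and "c \<equiv> decide R t \<omega>"
  shows "- B_const pl - purchase_metric V (theta pl V) q (supplies R t \<omega>) (buy c)
      + (\<Sum>k\<in>UNIV. of_bool (offer c k) * real (demand R t \<omega> k) * sale_value q k (price c k))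
    \<le> V * drift_profit q (noise t \<omega>)"
proof -
  define g where "g m = of_int (q m) - theta pl V m" for m
  define a where "a m = real_of_int (buy c m)" for m
  define u where "u m = real_of_int (units_used t \<omega> m)" for m
  have next_g: "of_int (inventory R (Suc t) \<omega> m) - theta pl V m = g m + (a m - u m)" for m
    by (simp add: inventory_Suc[OF \<omega>] g_def a_def u_def q_def c_def)
  have sq: "(a m - u m)\<^sup>2 \<le> max ((buy_max pl m)\<^sup>2) ((real (mu_max pl m))\<^sup>2)" for m
  proof -
    have a: "0 \<le> a m" "a m \<le> buy_max pl m"
      using buy_bounds[OF \<omega>, of t m] by (auto simp: a_def c_def)
    have "of_int (units_used t \<omega> m) \<le> (of_int (int (mu_max pl m)) :: real)"
      using units_used_bounds(2)[OF \<omega>, of t m] by (simp only: of_int_le_iff)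
    then have u: "0 \<le> u m" "u m \<le> real (mu_max pl m)"
      using units_used_bounds(1)[OF \<omega>, of t m] by (auto simp: u_def)
    have "(a m - u m)\<^sup>2 \<le> (buy_max pl m)\<^sup>2" if "u m \<le> a m"
      using that a u by (intro power_mono) auto
    moreover have "(a m - u m)\<^sup>2 \<le> (real (mu_max pl m))\<^sup>2" if "a m \<le> u m"
      using that a u power_mono[of "u m - a m" "real (mu_max pl m)" 2] by (simp add: power2_commute)
    ultimately show ?thesis by (cases "u m \<le> a m") auto
  qed
  have "lyap (inventory R (Suc t) \<omega>) - lyap q
      = (1/2) * (\<Sum>m\<in>UNIV. (g m + (a m - u m))\<^sup>2 - (g m)\<^sup>2)"
    by (simp add: lyap_def lyapunov_def next_g g_def sum_subtractf right_diff_distrib)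
  also have "(\<Sum>m\<in>UNIV. (g m + (a m - u m))\<^sup>2 - (g m)\<^sup>2) = (\<Sum>m\<in>UNIV. 2 * (g m * (a m - u m)) + (a m - u m)\<^sup>2)"
    by (intro sum.cong refl) (simp add: power2_eq_square algebra_simps)
  also have "\<dots> \<le> (\<Sum>m\<in>UNIV. 2 * (g m * (a m - u m)) + max ((buy_max pl m)\<^sup>2) ((real (mu_max pl m))\<^sup>2))"
    using sq by (intro sum_mono add_left_mono)
  finally have drift: "lyap (inventory R (Suc t) \<omega>) - lyap q \<le> (\<Sum>m\<in>UNIV. g m * (a m - u m)) + B_const pl"
    by (simp add: B_const_def sum.distrib sum_distrib_left[symmetric])
  have used: "(\<Sum>m\<in>UNIV. g m * u m)
      = (\<Sum>k\<in>UNIV. of_bool (offer c k) * real (demand R t \<omega> k) * (\<Sum>m\<in>UNIV. real (beta pl m k) * g m))"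
    unfolding u_def units_used_def c_def sum_distrib_left of_int_sum
    by (subst sum.swap) (intro sum.cong refl, simp)
  have sales: "(\<Sum>k\<in>UNIV. of_bool (offer c k) * real (demand R t \<omega> k) * sale_value q k (price c k))
      = V * (\<Sum>k\<in>UNIV. of_bool (offer c k) * real (demand R t \<omega> k) * (price c k - alpha pl k)) + (\<Sum>m\<in>UNIV. g m * u m)"
    unfolding used sale_value_def g_def[symmetric] sum_distrib_left[of V] sum.distrib[symmetric]
    by (intro sum.cong refl) (simp add: algebra_simps)
  have "V * drift_profit q (noise t \<omega>) = V * profit q (noise t \<omega>) - (lyap (inventory R (Suc t) \<omega>) - lyap q)"
    using V_pos by (simp add: drift_profit_def inventory_next[OF \<omega>] q_def field_simps)
  also have "profit q (noise t \<omega>) = - cost (buy c) (supplies R t \<omega>)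
      + (\<Sum>k\<in>UNIV. of_bool (offer c k) * real (demand R t \<omega> k) * (price c k - alpha pl k))"
    by (simp add: noise_def q_def c_def decide_by_rule[OF \<omega>])
  finally show ?thesis
    using drift sales
    by (simp add: purchase_metric_def g_def[symmetric] a_def[symmetric] sum_subtractf right_diff_distrib distrib_left mult.commute[of "a _"])
qed

lemma kernel_sample:
  assumes "q \<in> chain.reachable" "s \<in> set_pmf state_law" "d \<in> set_pmf (demand_kernel q s)"
  obtains t \<omega> where "\<omega> \<in> space M" "inventory R t \<omega> = q" "supplies R t \<omega> = fst s" "market R t \<omega> = snd s"
    "demand R t \<omega> = d"
proof -
  have "(s, d) \<in> set_pmf (kernel q)" using assms(2,3) by (auto simp: kernel_def)
  from chain.reachable_sample[OF assms(1) this] obtain t \<omega>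
    where "\<omega> \<in> space M" "inventory R t \<omega> = q" "noise t \<omega> = (s, d)" by blast
  then show ?thesis by (intro that[of \<omega> t]) (auto simp: noise_def)
qed

text \<open>Given the states, averaging over the demand replaces each demand by its mean, and the lower bound of
\<open>drift_bound\<close> becomes the sum of the optimised metrics.  No product is short because of the lower
inventory bound, so the pricing comparison covers all products.\<close>

lemma conditional_drift_ge_policy:
  assumes q: "q \<in> chain.reachable" and s: "s \<in> set_pmf state_law"
    and \<gamma>: "purchase_policy pl \<gamma>" and \<nu>: "pricing_policy pl \<nu>"
  shows "- B_const pl - (V * spending \<gamma> (fst s) + (\<Sum>m\<in>UNIV. min 0 (of_int (q m) - theta pl V m) * purchased \<gamma> m (fst s)))
      + (V * revenue \<nu> (snd s) + (\<Sum>m\<in>UNIV. (of_int (q m) - theta pl V m) * consumed \<nu> m (snd s)))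
    \<le> measure_pmf.expectation (demand_kernel q s) (\<lambda>d. V * drift_profit q (s, d))"
proof -
  define x where "x = fst s"
  define y where "y = snd s"
  define c where "c = decision_rule q x y"
  define J where "J = demand_kernel q s"
  define v where "v k = of_bool (offer c k) * pricing_metric pl V (theta pl V) q y k (price c k)" for k
  obtain d0 where "d0 \<in> set_pmf J" using set_pmf_not_empty by fast
  then obtain t \<omega> where \<omega>: "\<omega> \<in> space M" "inventory R t \<omega> = q" "supplies R t \<omega> = x" "market R t \<omega> = y"
    unfolding x_def y_def J_def using kernel_sample[OF q s] by metis
  have dec: "decide R t \<omega> = c" using decide_by_rule[OF \<omega>(1), of t] \<omega> by (simp add: c_def)
  have x: "x \<in> supply_states pl" and y: "y \<in> demand_states pl" and price: "\<And>k. price c k \<in> price_set pl k"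
    using supply_in[OF \<omega>(1), of t] market_in[OF \<omega>(1), of t] price_feasible[OF \<omega>(1), of t] \<omega> dec by auto
  have jpp: "jpp_decision pl V (theta pl V) q x y c"
    using jpp[OF \<omega>(1), of t] \<omega> dec by simp
  have q_ge: "int (mu_max pl m) \<le> q m" for m using inventory_range[OF \<omega>(1), of m t] \<omega>(2) by simp
  have notshort: "\<not> short pl q k" for k using q_ge by (auto simp: short_def not_less)
  have buy: "purchase_metric V (theta pl V) q x (buy c) \<le> V * spending \<gamma> x
      + (\<Sum>m\<in>UNIV. min 0 (of_int (q m) - theta pl V m) * purchased \<gamma> m x)"
    using jpp by (intro min_purchase_le_policy[OF V_pos \<gamma> x]) (simp add: jpp_decision_def)
  have sell: "V * revenue \<nu> y + (\<Sum>m\<in>UNIV. (of_int (q m) - theta pl V m) * consumed \<nu> m y) \<le> (\<Sum>k\<in>UNIV. v k)"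
  proof (rule policy_le_best_prices[OF \<nu> y])
    fix k
    have k: "is_arg_max (pricing_metric pl V (theta pl V) q y k) (\<lambda>p. p \<in> price_set pl k) (price c k)"
      "offer c k \<longleftrightarrow> 0 < pricing_metric pl V (theta pl V) q y k (price c k)"
      using jpp notshort[of k] unfolding jpp_decision_def by (metis (no_types))+
    then show "0 \<le> v k" by (auto simp: v_def)
    show "pricing_metric pl V (theta pl V) q y k p \<le> v k" if "p \<in> price_set pl k" for p
      using k that by (auto simp: v_def is_arg_max_linorder not_less intro: order_trans)
  qed
  have fin: "finite (set_pmf J)"
  proof (rule finite_subset)
    show "set_pmf J \<subseteq> (\<Pi>\<^sub>E k\<in>UNIV. {..demand_max pl k})"
      unfolding J_def using kernel_sample[OF q s] demand_le by (auto simp: PiE_def) metis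
  qed (intro finite_PiE; simp)
  have Ed: "measure_pmf.expectation J (\<lambda>d. real (d k)) = mean_demand pl k (price c k) y" for k
  proof -
    have "map_pmf (\<lambda>d. d k) J = demand_law pl k (price c k) y"
      unfolding J_def demand_kernel_def x_def[symmetric] y_def[symmetric] c_def[symmetric]
      by (rule joint_demand_marginal[OF price y])
    from arg_cong[OF this, of "\<lambda>p. measure_pmf.expectation p real"]
    show ?thesis by (simp add: mean_demand_def)
  qed
  let ?low = "\<lambda>d. - B_const pl - purchase_metric V (theta pl V) q x (buy c)
      + (\<Sum>k\<in>UNIV. of_bool (offer c k) * real (d k) * sale_value q k (price c k))"
  have "measure_pmf.expectation J ?low = - B_const pl - purchase_metric V (theta pl V) q x (buy c)
      + (\<Sum>k\<in>UNIV. of_bool (offer c k) * measure_pmf.expectation J (\<lambda>d. real (d k)) * sale_value q k (price c k))"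
    using integrable_measure_pmf_finite[OF fin, where 'b=real] by simp
  also have "\<dots> = - B_const pl - purchase_metric V (theta pl V) q x (buy c) + (\<Sum>k\<in>UNIV. v k)"
    by (simp add: Ed v_def sale_value_def pricing_metric_eq mult.assoc)
  finally have low: "measure_pmf.expectation J ?low = - B_const pl - purchase_metric V (theta pl V) q x (buy c) + (\<Sum>k\<in>UNIV. v k)" .
  have "?low d \<le> V * drift_profit q (s, d)" if d: "d \<in> set_pmf J" for d
  proof -
    obtain t \<omega> where \<omega>: "\<omega> \<in> space M" "inventory R t \<omega> = q" "supplies R t \<omega> = x" "market R t \<omega> = y" "demand R t \<omega> = d"
      unfolding x_def y_def using kernel_sample[OF q s d[unfolded J_def]] by metis
    have "decide R t \<omega> = c" using decide_by_rule[OF \<omega>(1), of t] \<omega> by (simp add: c_def)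
    moreover have "noise t \<omega> = (s, d)" using \<omega> by (simp add: noise_def x_def y_def)
    ultimately show ?thesis using drift_bound[OF \<omega>(1), of t] by (simp add: \<omega>)
  qed
  then have "measure_pmf.expectation J ?low \<le> measure_pmf.expectation J (\<lambda>d. V * drift_profit q (s, d))"
    by (intro integral_mono_AE integrable_measure_pmf_finite fin) (auto simp: AE_measure_pmf_iff)
  with low buy sell show ?thesis unfolding x_def y_def J_def by linarith
qed

text \<open>Below a threshold the weight \<open>q m - \<theta> m\<close> is nonpositive and a surplus of purchases over consumption
helps; above it the purchases have been dropped from the comparison, and consumption has a positive
weight.  In both cases material \<open>m\<close> contributes a nonnegative amount.\<close>

lemma mean_drift_ge_policy:
  assumes q: "q \<in> chain.reachable"
    and \<gamma>: "purchase_policy pl \<gamma>" and \<nu>: "pricing_policy pl \<nu>"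
    and feasible: "\<And>m. mu_hat pl \<nu> m \<le> a_hat pl \<gamma> m"
  shows "V * (- c_hat pl \<gamma> + r_hat pl \<nu>) - B_const pl \<le> V * chain.mean drift_profit q"
proof -
  define g where "g m = of_int (q m) - theta pl V m" for m
  obtain C where C: "\<And>t \<omega>. \<omega> \<in> space M \<Longrightarrow> \<bar>drift_profit (inventory R t \<omega>) (noise t \<omega>)\<bar> \<le> C"
    using drift_profit_bounded by blast
  have bd: "\<bar>drift_profit q w\<bar> \<le> C" if "w \<in> set_pmf (kernel q)" for w
    using chain.reachable_sample[OF q that] C by metis
  have mean: "V * chain.mean drift_profit q
      = measure_pmf.expectation state_law (\<lambda>s. measure_pmf.expectation (demand_kernel q s) (\<lambda>d. V * drift_profit q (s, d)))"
  proof -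
    have "chain.mean drift_profit q
        = measure_pmf.expectation state_law (\<lambda>s. measure_pmf.expectation (demand_kernel q s) (\<lambda>d. drift_profit q (s, d)))"
      unfolding chain.mean_def kernel_def
      by (subst integral_bind_pmf_bounded[where C=C]) (use bd in \<open>auto simp: kernel_def\<close>)
    then show ?thesis by simp
  qed
  have sup: "fst s \<in> supply_states pl" "snd s \<in> demand_states pl" if "s \<in> set_pmf state_law" for s
    using that supply_pmf demand_state_pmf unfolding state_law_marginals[symmetric] by auto
  note i[simp] =
    pmf_integrable_bounded[OF purchase_policy_bounds(1)[OF \<gamma> sup(1)]]
    pmf_integrable_bounded[OF purchase_policy_bounds(2)[OF \<gamma> sup(1)]]
    pmf_integrable_bounded[OF pricing_policy_bounds(1)[OF \<nu> sup(2)]]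
    pmf_integrable_bounded[OF pricing_policy_bounds(3)[OF \<nu> sup(2)]]
  have E: "measure_pmf.expectation state_law (\<lambda>s. spending \<gamma> (fst s)) = c_hat pl \<gamma>"
    "measure_pmf.expectation state_law (\<lambda>s. purchased \<gamma> m (fst s)) = a_hat pl \<gamma> m"
    "measure_pmf.expectation state_law (\<lambda>s. revenue \<nu> (snd s)) = r_hat pl \<nu>"
    "measure_pmf.expectation state_law (\<lambda>s. consumed \<nu> m (snd s)) = mu_hat pl \<nu> m" for m
    unfolding hat_expectations[OF \<gamma> \<nu>, symmetric] state_law_marginals[symmetric] by simp_all
  have mu0: "0 \<le> mu_hat pl \<nu> m" for m
    unfolding E(4)[symmetric] using pricing_policy_bounds(2)[OF \<nu> sup(2)]
    by (intro integral_nonneg_AE) (auto simp: AE_measure_pmf_iff)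
  let ?G = "\<lambda>s. - B_const pl - (V * spending \<gamma> (fst s) + (\<Sum>m\<in>UNIV. min 0 (g m) * purchased \<gamma> m (fst s)))
      + (V * revenue \<nu> (snd s) + (\<Sum>m\<in>UNIV. g m * consumed \<nu> m (snd s)))"
  have "0 \<le> (\<Sum>m\<in>UNIV. g m * mu_hat pl \<nu> m - min 0 (g m) * a_hat pl \<gamma> m)"
  proof (rule sum_nonneg)
    fix m
    show "0 \<le> g m * mu_hat pl \<nu> m - min 0 (g m) * a_hat pl \<gamma> m"
    proof (cases "g m \<le> 0")
      case True
      then show ?thesis using mult_left_mono_neg[OF feasible True, of m] by (simp add: min_def)
    next
      case False
      then show ?thesis using mu0[of m] by simp
    qed
  qed
  then have "V * (- c_hat pl \<gamma> + r_hat pl \<nu>) - B_const pl \<le> - B_const pl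
      - (V * c_hat pl \<gamma> + (\<Sum>m\<in>UNIV. min 0 (g m) * a_hat pl \<gamma> m))
      + (V * r_hat pl \<nu> + (\<Sum>m\<in>UNIV. g m * mu_hat pl \<nu> m))"
    by (simp add: sum_subtractf algebra_simps)
  also have "\<dots> = measure_pmf.expectation state_law ?G"
    by (simp add: E)
  also have "\<dots> \<le> V * chain.mean drift_profit q"
    unfolding mean
  proof (rule integral_mono_AE)
    show "AE s in state_law. ?G s \<le> measure_pmf.expectation (demand_kernel q s) (\<lambda>d. V * drift_profit q (s, d))"
      using conditional_drift_ge_policy[OF q _ \<gamma> \<nu>] by (auto simp: AE_measure_pmf_iff g_def)
    show "integrable state_law (\<lambda>s. measure_pmf.expectation (demand_kernel q s) (\<lambda>d. V * drift_profit q (s, d)))"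
    proof (rule pmf_integrable_bounded, rule abs_pmf_expectation_le)
      fix s d assume "s \<in> set_pmf state_law" "d \<in> set_pmf (demand_kernel q s)"
      then have "(s, d) \<in> set_pmf (kernel q)" by (auto simp: kernel_def)
      then show "\<bar>V * drift_profit q (s, d)\<bar> \<le> V * C"
        using bd V_pos by (simp add: abs_mult)
    qed
  qed simp
  finally show ?thesis .
qed

lemma mean_drift_ge:
  assumes q: "q \<in> chain.reachable"
  shows "phi_opt pl - B_const pl / V \<le> chain.mean drift_profit q"
proof -
  have "phi_opt pl \<le> chain.mean drift_profit q + B_const pl / V"
    unfolding phi_opt_def
  proof (rule cSup_least[OF achievable_profits_nonempty])
    fix v assume "v \<in> achievable_profits pl"
    then obtain \<gamma> \<nu> where "v = - c_hat pl \<gamma> + r_hat pl \<nu>" "purchase_policy pl \<gamma>" "pricing_policy pl \<nu>"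
      "\<And>m. mu_hat pl \<nu> m \<le> a_hat pl \<gamma> m"
      unfolding achievable_profits_def by blast
    with mean_drift_ge_policy[OF q, of \<gamma> \<nu>] have "V * v - B_const pl \<le> V * chain.mean drift_profit q" by simp
    then show "v \<le> chain.mean drift_profit q + B_const pl / V"
      using V_pos by (simp add: field_simps)
  qed
  then show ?thesis by simp
qed

lemma finite_reachable: "finite chain.reachable"
proof (rule finite_subset[OF _ finite_inventories])
  show "chain.reachable \<subseteq> {q. \<exists>t. \<exists>\<omega>\<in>space M. q = inventory R t \<omega>}"
  proof
    fix q assume q: "q \<in> chain.reachable"
    obtain w where "w \<in> set_pmf (kernel q)" using set_pmf_not_empty by fast
    from chain.reachable_sample[OF q this] show "q \<in> {q. \<exists>t. \<exists>\<omega>\<in>space M. q = inventory R t \<omega>}" by blast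
  qed
qed

lemma expected_average_profit_ge:
  assumes t: "0 < t"
  shows "phi_opt pl - B_const pl / V - expectation (\<lambda>\<omega>. lyap (inventory R 0 \<omega>)) / (V * real t)
    \<le> (1 / real t) * (\<Sum>\<tau><t. expectation (phi_actual pl R \<tau>))"
proof -
  obtain C where C: "\<And>t \<omega>. \<omega> \<in> space M \<Longrightarrow> \<bar>drift_profit (inventory R t \<omega>) (noise t \<omega>)\<bar> \<le> C"
    using drift_profit_bounded by blast
  obtain C1 where C1: "\<And>t \<omega>. \<omega> \<in> space M \<Longrightarrow> \<bar>phi_actual pl R t \<omega>\<bar> \<le> C1" using phi_actual_bounded by blast
  obtain C2 where C2: "\<And>t \<omega>. \<omega> \<in> space M \<Longrightarrow> \<bar>lyap (inventory R t \<omega>)\<bar> \<le> C2" using lyap_bounded by blast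
  have iL: "integrable M (\<lambda>\<omega>. lyap (inventory R \<tau> \<omega>))" for \<tau>
    using C2 by (intro discrete_rv_integrable[OF inventory_rv, where C=C2] AE_I2)
  have "integrable M (\<lambda>\<omega>. profit (inventory R \<tau> \<omega>) (noise \<tau> \<omega>))" for \<tau>
    using discrete_rv_integrable[OF chain.state_noise_rv[of \<tau>], of "\<lambda>(q, w). profit q w" C1]
      C1 phi_actual_profit by (auto intro: AE_I2)
  then have i\<phi>: "integrable M (phi_actual pl R \<tau>)" for \<tau>
    by (subst Bochner_Integration.integrable_cong[OF refl phi_actual_profit])
  define L where "L \<tau> = expectation (\<lambda>\<omega>. lyap (inventory R \<tau> \<omega>))" for \<tau>
  have step: "phi_opt pl - B_const pl / V + (L (Suc \<tau>) - L \<tau>) / V \<le> expectation (phi_actual pl R \<tau>)" for \<tau>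
  proof -
    have "phi_opt pl - B_const pl / V \<le> expectation (\<lambda>\<omega>. drift_profit (inventory R \<tau> \<omega>) (noise \<tau> \<omega>))"
      by (rule chain.expectation_ge[OF C mean_drift_ge])
    also have "\<dots> = expectation (\<lambda>\<omega>. phi_actual pl R \<tau> \<omega> - (lyap (inventory R (Suc \<tau>) \<omega>) - lyap (inventory R \<tau> \<omega>)) / V)"
      by (intro Bochner_Integration.integral_cong refl drift_profit_run)
    also have "\<dots> = expectation (phi_actual pl R \<tau>) - (L (Suc \<tau>) - L \<tau>) / V"
      using iL i\<phi> by (simp add: L_def)
    finally show ?thesis by simp
  qed
  have "0 \<le> L t"
    unfolding L_def lyap_def lyapunov_def by (intro Bochner_Integration.integral_nonneg) (auto intro: sum_nonneg)
  \<comment> \<open>The final value of the Lyapunov function is dropped.\<close>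
  then have "- (L 0 / V) \<le> (L t - L 0) / V"
    using V_pos by (simp add: field_simps)
  also have "\<dots> = (\<Sum>\<tau><t. (L (Suc \<tau>) - L \<tau>) / V)"
    by (simp add: sum_divide_distrib[symmetric] sum_lessThan_telescope)
  finally have "real t * (phi_opt pl - B_const pl / V) - L 0 / V
      \<le> (\<Sum>\<tau><t. phi_opt pl - B_const pl / V + (L (Suc \<tau>) - L \<tau>) / V)"
    by (simp add: sum.distrib)
  also have "\<dots> \<le> (\<Sum>\<tau><t. expectation (phi_actual pl R \<tau>))"
    by (intro sum_mono step)
  finally have "(1 / real t) * (real t * (phi_opt pl - B_const pl / V) - L 0 / V)
      \<le> (1 / real t) * (\<Sum>\<tau><t. expectation (phi_actual pl R \<tau>))"
    by (intro mult_left_mono) auto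
  then show ?thesis using t by (simp add: L_def right_diff_distrib mult.commute[of V])
qed

text \<open>The averages of the profit and of the drift-corrected profit differ by a bounded telescoped sum divided
by the number of slots.\<close>

lemma average_profit_converges:
  "AE \<omega> in M. \<exists>l. (\<lambda>t. (1 / real t) * (\<Sum>\<tau><t. phi_actual pl R \<tau> \<omega>)) \<longlonglongrightarrow> l
     \<and> phi_opt pl - B_const pl / V \<le> l"
proof -
  obtain C where C: "\<And>t \<omega>. \<omega> \<in> space M \<Longrightarrow> \<bar>drift_profit (inventory R t \<omega>) (noise t \<omega>)\<bar> \<le> C"
    using drift_profit_bounded by blast
  obtain C2 where C2: "\<And>t \<omega>. \<omega> \<in> space M \<Longrightarrow> \<bar>lyap (inventory R t \<omega>)\<bar> \<le> C2" using lyap_bounded by blast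
  have "AE \<omega> in M. \<exists>l. (\<lambda>n. (\<Sum>t<n. drift_profit (inventory R t \<omega>) (noise t \<omega>)) / real n) \<longlonglongrightarrow> l
      \<and> phi_opt pl - B_const pl / V \<le> l"
    by (rule chain.time_averages_converge_ge[OF finite_reachable C mean_drift_ge])
  then show ?thesis
    using AE_space
  proof eventually_elim
    case (elim \<omega>)
    then obtain l where l: "(\<lambda>n. (\<Sum>t<n. drift_profit (inventory R t \<omega>) (noise t \<omega>)) / real n) \<longlonglongrightarrow> l"
      and ge: "phi_opt pl - B_const pl / V \<le> l" by blast
    define L where "L t = lyap (inventory R t \<omega>)" for t
    have "(\<lambda>n. ((L n - L 0) / V) / real n) \<longlonglongrightarrow> 0"
    proof (rule bounded_over_n_tendsto_0)
      fix n
      have "\<bar>L n - L 0\<bar> \<le> 2 * C2"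
        using C2[OF elim(2), of n] C2[OF elim(2), of 0] unfolding L_def by linarith
      then show "\<bar>(L n - L 0) / V\<bar> \<le> 2 * C2 / V"
        using V_pos by (simp add: divide_right_mono)
    qed
    from tendsto_add[OF l this]
    have lim: "(\<lambda>n. (\<Sum>t<n. drift_profit (inventory R t \<omega>) (noise t \<omega>)) / real n + ((L n - L 0) / V) / real n) \<longlonglongrightarrow> l"
      by simp
    have eq: "(\<Sum>t<n. drift_profit (inventory R t \<omega>) (noise t \<omega>)) / real n + ((L n - L 0) / V) / real n
        = (1 / real n) * (\<Sum>\<tau><n. phi_actual pl R \<tau> \<omega>)" for n
    proof -
      have "(\<Sum>t<n. drift_profit (inventory R t \<omega>) (noise t \<omega>))
          = (\<Sum>t<n. phi_actual pl R t \<omega>) - (\<Sum>t<n. L (Suc t) - L t) / V"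
        by (simp only: drift_profit_run[OF elim(2)] L_def sum_subtractf sum_divide_distrib diff_divide_distrib)
      then show ?thesis by (simp add: sum_lessThan_telescope diff_divide_distrib)
    qed
    from lim ge show ?case unfolding eq by blast
  qed
qed

end

theorem theorem3:
  fixes pl :: "('m::finite, 'k::finite, 'y) plant"
    and M :: "'w measure"
    and R :: "('w, 'm, 'k, 'y) trajectory"
    and V :: real
  assumes "0 < V"
    and "jpp_run pl M R V (theta pl V)"
    and "\<And>\<omega> m. \<omega> \<in> space M \<Longrightarrow>
           real (mu_max pl m) \<le> of_int (inventory R 0 \<omega> m) \<and>
           of_int (inventory R 0 \<omega> m) \<le> theta pl V m + buy_max pl m"
    and "iid_states M R"
  shows "(\<forall>m. (\<forall>t. \<forall>\<omega>\<in>space M.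
                 real (mu_max pl m) \<le> of_int (inventory R t \<omega> m) \<and>
                 of_int (inventory R t \<omega> m) \<le> Q_max pl V m) \<and>
              (\<lambda>V'. Q_max pl V' m) \<in> O(\<lambda>V'. V'))
       \<and> (\<forall>t>0. (1 / real t) * (\<Sum>\<tau><t. \<integral>\<omega>. phi_actual pl R \<tau> \<omega> \<partial>M)
            \<ge> phi_opt pl - B_const pl / V
               - (\<integral>\<omega>. lyapunov (theta pl V) (inventory R 0 \<omega>) \<partial>M) / (V * real t))
       \<and> (AE \<omega> in M. \<exists>l. (\<lambda>t. (1 / real t) * (\<Sum>\<tau><t. phi_actual pl R \<tau> \<omega>)) \<longlonglongrightarrow> l
            \<and> l \<ge> phi_opt pl - B_const pl / V)"
proof -
  have "jpp_iid_run pl M R V"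
  proof (rule jpp_iid_run.intro[OF assms(2)], rule jpp_iid_run_axioms.intro)
    show "0 < V" by (fact assms)
    show "iid_states M R" by (fact assms)
    show "real (mu_max pl m) \<le> of_int (inventory R 0 \<omega> m)" if "\<omega> \<in> space M" for \<omega> m
      using assms(3)[OF that] by blast
    show "of_int (inventory R 0 \<omega> m) \<le> Q_max pl V m" if "\<omega> \<in> space M" for \<omega> m
      unfolding Q_max_def using assms(3)[OF that] by blast
  qed
  then interpret jpp_iid_run pl M R V .
  show ?thesis
    using real_inventory_range Q_max_bigo expected_average_profit_ge average_profit_converges
    unfolding lyap_def by blast
qed

end
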